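(* Let $d\ge 1$, let $F$ be a probability distribution on $\mathbb{R}^d$, and let $X_1,\dots,X_n$ be a random sample (i.i.d.) from $F$. Let $n=n_1+n_2$, and let $l$ be the jackknife empirical log-likelihood ratio (defined in the context) computed from the sample split into its first $n_1$ and last $n_2$ observations. Assume: (C1) $0<\sigma_{g_k}<\infty$ for $k=1,2$, where $\sigma_{g_1}^2=\operatorname{Var}(g_1(X_1))$, $\sigma_{g_2}^2=\operatorname{Var}(g_2(X_1))$, $g_1(x)=\mathbb{E}\|x+X_2\|-\theta_0$, $g_2(x)=\mathbb{E}\|x-X_2\|-\theta_0$ for $x\in\mathbb{R}^d$, and $\theta_0=\mathbb{E}\|X_1-X_2\|$; (C2) $n=n_1+n_2$, $n_k/n\to\alpha_k>0$ for $k=1,2$, and $\alpha_1+\alpha_2=1$. Then the test of the null hypothesis $H_0$ of diagonal symmetry ($X_1$ and $-X_1$ have the same distribution) that rejects $H_0$ when $l>\chi^2_{1,1-\alpha}$ is consistent for any fixed alternative. That is, for any fixed $F$ under which $X_1$ and $-X_1$ do not have the same distribution (alternative $H_a$), $$P_{H_a}\big(l>\chi^2_{1,1-\alpha}\big)\to 1\qquad\text{as } n\to\infty,$$ where $\alpha\in(0,1)$ is the significance level and $\chi^2_{1,1-\alpha}$ is the $100(1-\alpha)\%$ quantile of the chi-square distribution with one degree of freedom.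
   Context: $\|\cdot\|$ is the Euclidean norm on $\mathbb{R}^d$. Put $Y_i=X_{n_1+i}$ for $i=1,\dots,n_2$, and let $h_1(s,t)=\|s+t\|$, $h_2(s,t)=\|s-t\|$. Define the U-statistics $$U_1=\binom{n_1}{2}^{-1}\sum_{1\le k<j\le n_1}h_1(X_k,X_j),\qquad U_2=\binom{n_2}{2}^{-1}\sum_{1\le k<j\le n_2}h_2(Y_k,Y_j),$$ their leave-one-out versions $$U^{(-i)}_{1,n_1-1}=\binom{n_1-1}{2}^{-1}\sum_{\substack{1\le j<k\le n_1\\ j,k\ne i}}h_1(X_j,X_k),\qquad U^{(-i)}_{2,n_2-1}=\binom{n_2-1}{2}^{-1}\sum_{\substack{1\le j<k\le n_2\\ j,k\ne i}}h_2(Y_j,Y_k),$$ and the jackknife pseudo-values $$\hat V^{(1)}_i=n_1U_1-(n_1-1)U^{(-i)}_{1,n_1-1}\ (i=1,\dots,n_1),\qquad \hat V^{(2)}_i=n_2U_2-(n_2-1)U^{(-i)}_{2,n_2-1}\ (i=1,\dots,n_2).$$ The maximum constrained jackknife empirical likelihood is $$L=\max_{p,q,\theta}\Big(\prod_{i=1}^{n_1}p_i\Big)\Big(\prod_{j=1}^{n_2}q_j\Big)$$ subject to $p_i\ge0$, $\sum_{i=1}^{n_1}p_i=1$, $\sum_{i=1}^{n_1}p_i(\hat V^{(1)}_i-\theta)=0$, $q_j\ge0$, $\sum_{j=1}^{n_2}q_j=1$, $\sum_{j=1}^{n_2}q_j(\hat V^{(2)}_j-\theta)=0$. By Lagrange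 multipliers, $$p_i=\frac{1}{n_1}\,\frac{1}{1+\lambda_1(\hat V^{(1)}_i-\theta)},\qquad q_j=\frac{1}{n_2}\,\frac{1}{1+\lambda_2(\hat V^{(2)}_j-\theta)},$$ where $(\lambda_1,\lambda_2,\theta)$ satisfies $$\sum_{i=1}^{n_1}\frac{\hat V^{(1)}_i-\theta}{1+\lambda_1(\hat V^{(1)}_i-\theta)}=0,\qquad \sum_{j=1}^{n_2}\frac{\hat V^{(2)}_j-\theta}{1+\lambda_2(\hat V^{(2)}_j-\theta)}=0,$$ $$\lambda_1\sum_{i=1}^{n_1}\frac{-1}{1+\lambda_1(\hat V^{(1)}_i-\theta)}+\lambda_2\sum_{j=1}^{n_2}\frac{-1}{1+\lambda_2(\hat V^{(2)}_j-\theta)}=0.$$ Without the constraints involving $\theta$, the product of the $p_i$ and $q_j$ is maximized at $p_i=1/n_1$, $q_j=1/n_2$; the jackknife empirical log-likelihood ratio is accordingly $$l=2\sum_{i=1}^{n_1}\log\{1+\lambda_1(\hat V^{(1)}_i-\theta)\}+2\sum_{i=1}^{n_2}\log\{1+\lambda_2(\hat V^{(2)}_i-\theta)\},$$ where $(\lambda_1,\lambda_2,\theta)$ satisfies the three equations above. *)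

theory Defs
  imports "HOL-Probability.Probability"
begin

section \<open>Jackknife pseudo-values\<close>

definition ustat :: "('a \<Rightarrow> 'a \<Rightarrow> real) \<Rightarrow> (nat \<Rightarrow> 'a) \<Rightarrow> nat set \<Rightarrow> real" where
  "ustat h Z I = (\<Sum>(k, j) | k \<in> I \<and> j \<in> I \<and> k < j. h (Z k) (Z j)) / real (card I choose 2)"

definition jack_pseudo :: "('a \<Rightarrow> 'a \<Rightarrow> real) \<Rightarrow> (nat \<Rightarrow> 'a) \<Rightarrow> nat \<Rightarrow> nat \<Rightarrow> real" where
  "jack_pseudo h Z m i =
     real m * ustat h Z {1..m} - (real m - 1) * ustat h Z ({1..m} - {i})"

definition h1 :: "'a::real_normed_vector \<Rightarrow> 'a \<Rightarrow> real" where
  "h1 s t = norm (s + t)"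

definition h2 :: "'a::real_normed_vector \<Rightarrow> 'a \<Rightarrow> real" where
  "h2 s t = norm (s - t)"


section \<open>The jackknife empirical log-likelihood ratio\<close>

text \<open>
  Solutions \<open>(lam1, lam2, \<theta>)\<close> of the Lagrange equations for two samples \<open>V1 1, \<dots>, V1 m1\<close> and
  \<open>V2 1, \<dots>, V2 m2\<close>. Positivity of the denominators is the constraint that
  \<open>p i = 1 / (m1 * (1 + lam1 * (V1 i - \<theta>)))\<close> and \<open>q j = 1 / (m2 * (1 + lam2 * (V2 j - \<theta>)))\<close>
  are nonnegative; it also makes the logarithms in \<open>jel_value\<close> meaningful.
\<close>

definition jel_solution ::
    "(nat \<Rightarrow> real) \<Rightarrow> nat \<Rightarrow> (nat \<Rightarrow> real) \<Rightarrow> nat \<Rightarrow> real \<Rightarrow> real \<Rightarrow> real \<Rightarrow> bool" where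
  "jel_solution V1 m1 V2 m2 lam1 lam2 \<theta> \<longleftrightarrow>
     (\<forall>i\<in>{1..m1}. 0 < 1 + lam1 * (V1 i - \<theta>)) \<and>
     (\<forall>j\<in>{1..m2}. 0 < 1 + lam2 * (V2 j - \<theta>)) \<and>
     (\<Sum>i=1..m1. (V1 i - \<theta>) / (1 + lam1 * (V1 i - \<theta>))) = 0 \<and>
     (\<Sum>j=1..m2. (V2 j - \<theta>) / (1 + lam2 * (V2 j - \<theta>))) = 0 \<and>
     lam1 * (\<Sum>i=1..m1. -1 / (1 + lam1 * (V1 i - \<theta>))) +
     lam2 * (\<Sum>j=1..m2. -1 / (1 + lam2 * (V2 j - \<theta>))) = 0"

definition jel_value ::
    "(nat \<Rightarrow> real) \<Rightarrow> nat \<Rightarrow> (nat \<Rightarrow> real) \<Rightarrow> nat \<Rightarrow> real \<Rightarrow> real \<Rightarrow> real \<Rightarrow> real" where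
  "jel_value V1 m1 V2 m2 lam1 lam2 \<theta> =
     2 * (\<Sum>i=1..m1. ln (1 + lam1 * (V1 i - \<theta>))) +
     2 * (\<Sum>j=1..m2. ln (1 + lam2 * (V2 j - \<theta>)))"

text \<open>
  If there is no solution, then no feasible \<open>(p, q, \<theta>)\<close> has all weights positive, so the
  constrained maximum likelihood is \<open>0\<close> (or there is no feasible point at all). As usual for
  empirical likelihood, the log-likelihood ratio is then \<open>\<infinity>\<close>. If there is a solution, the
  value does not depend on which one is used (lemma \<open>jel_value_unique\<close> below).
\<close>

definition jel_llr :: "(nat \<Rightarrow> real) \<Rightarrow> nat \<Rightarrow> (nat \<Rightarrow> real) \<Rightarrow> nat \<Rightarrow> ereal" where
  "jel_llr V1 m1 V2 m2 =
     (if \<exists>lam1 lam2 \<theta>. jel_solution V1 m1 V2 m2 lam1 lam2 \<theta>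
      then ereal (THE l. \<exists>lam1 lam2 \<theta>. jel_solution V1 m1 V2 m2 lam1 lam2 \<theta> \<and>
                                  l = jel_value V1 m1 V2 m2 lam1 lam2 \<theta>)
      else \<infinity>)"

lemma sum_inverse_weights:
  fixes V :: "nat \<Rightarrow> real"
  assumes pos: "\<forall>i\<in>{1..m}. 0 < 1 + a * (V i - t)"
    and eq: "(\<Sum>i=1..m. (V i - t) / (1 + a * (V i - t))) = 0"
  shows "(\<Sum>i=1..m. 1 / (1 + a * (V i - t))) = real m"
proof -
  have "(\<Sum>i=1..m. 1 / (1 + a * (V i - t)))
      = (\<Sum>i=1..m. 1 - a * ((V i - t) / (1 + a * (V i - t))))"
    by (intro sum.cong refl) (use pos in \<open>force simp: field_simps\<close>)
  also have "\<dots> = real m"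
    by (simp only: sum_subtractf sum_distrib_left[symmetric] eq) simp
  finally show ?thesis .
qed

lemma sum_ln_weights_le:
  fixes V :: "nat \<Rightarrow> real"
  assumes pos: "\<forall>i\<in>{1..m}. 0 < 1 + a * (V i - t)"
    and pos': "\<forall>i\<in>{1..m}. 0 < 1 + a' * (V i - t')"
    and eq': "(\<Sum>i=1..m. (V i - t') / (1 + a' * (V i - t'))) = 0"
  shows "(\<Sum>i=1..m. ln (1 + a * (V i - t))) - (\<Sum>i=1..m. ln (1 + a' * (V i - t')))
         \<le> real m * a * (t' - t)"
proof -
  let ?d = "\<lambda>i. 1 + a' * (V i - t')"
  have "(\<Sum>i=1..m. ln (1 + a * (V i - t))) - (\<Sum>i=1..m. ln (?d i))
      = (\<Sum>i=1..m. ln ((1 + a * (V i - t)) / ?d i))"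
    unfolding sum_subtractf[symmetric]
    by (intro sum.cong refl) (use pos pos' in \<open>force simp: ln_div\<close>)
  also have "\<dots> \<le> (\<Sum>i=1..m. (1 + a * (V i - t)) / ?d i - 1)"
    by (intro sum_mono ln_le_minus_one) (use pos pos' in simp)
  also have "\<dots> = (\<Sum>i=1..m. (1 + a * (t' - t)) * (1 / ?d i) + a * ((V i - t') / ?d i) - 1)"
    by (intro sum.cong refl)
      (simp add: add_divide_distrib[symmetric] algebra_simps)
  also have "\<dots> = (1 + a * (t' - t)) * (\<Sum>i=1..m. 1 / ?d i)
                 + a * (\<Sum>i=1..m. (V i - t') / ?d i) - real m"
    by (simp only: sum_subtractf sum.distrib sum_distrib_left[symmetric]) simp
  also have "\<dots> = real m * a * (t' - t)"
    using sum_inverse_weights[OF pos' eq'] eq' by (simp add: algebra_simps)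
  finally show ?thesis .
qed

lemma jel_value_le:
  assumes s: "jel_solution V1 m1 V2 m2 lam1 lam2 \<theta>"
    and s': "jel_solution V1 m1 V2 m2 lam1' lam2' \<theta>'"
  shows "jel_value V1 m1 V2 m2 lam1 lam2 \<theta> \<le> jel_value V1 m1 V2 m2 lam1' lam2' \<theta>'"
proof -
  have "(\<Sum>i=1..m1. 1 / (1 + lam1 * (V1 i - \<theta>))) = real m1"
    "(\<Sum>j=1..m2. 1 / (1 + lam2 * (V2 j - \<theta>))) = real m2"
    by (intro sum_inverse_weights; use s in \<open>simp add: jel_solution_def\<close>)+
  then have bal: "lam1 * real m1 + lam2 * real m2 = 0"
    using s by (simp add: jel_solution_def sum_negf)
  have 1: "(\<Sum>i=1..m1. ln (1 + lam1 * (V1 i - \<theta>))) - (\<Sum>i=1..m1. ln (1 + lam1' * (V1 i - \<theta>')))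
         \<le> real m1 * lam1 * (\<theta>' - \<theta>)"
    by (intro sum_ln_weights_le; use s s' in \<open>simp add: jel_solution_def\<close>)
  have 2: "(\<Sum>j=1..m2. ln (1 + lam2 * (V2 j - \<theta>))) - (\<Sum>j=1..m2. ln (1 + lam2' * (V2 j - \<theta>')))
         \<le> real m2 * lam2 * (\<theta>' - \<theta>)"
    by (intro sum_ln_weights_le; use s s' in \<open>simp add: jel_solution_def\<close>)
  have "real m1 * lam1 * (\<theta>' - \<theta>) + real m2 * lam2 * (\<theta>' - \<theta>)
      = (lam1 * real m1 + lam2 * real m2) * (\<theta>' - \<theta>)"
    by (simp add: algebra_simps)
  with 1 2 bal show ?thesis
    by (simp add: jel_value_def)
qed

lemma jel_value_unique:
  assumes "jel_solution V1 m1 V2 m2 lam1 lam2 \<theta>" and "jel_solution V1 m1 V2 m2 lam1' lam2' \<theta>'"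
  shows "jel_value V1 m1 V2 m2 lam1 lam2 \<theta> = jel_value V1 m1 V2 m2 lam1' lam2' \<theta>'"
  by (intro antisym jel_value_le assms)

definition jel_stat :: "nat \<Rightarrow> nat \<Rightarrow> (nat \<Rightarrow> 'a::real_normed_vector) \<Rightarrow> ereal" where
  "jel_stat m1 m2 x =
     jel_llr (jack_pseudo h1 x m1) m1 (jack_pseudo h2 (\<lambda>i. x (m1 + i)) m2) m2"


section \<open>Moments\<close>

definition theta0 :: "'w measure \<Rightarrow> (nat \<Rightarrow> 'w \<Rightarrow> 'a::real_normed_vector) \<Rightarrow> real" where
  "theta0 M X = prob_space.expectation M (\<lambda>\<omega>. norm (X 1 \<omega> - X 2 \<omega>))"

definition g1 :: "'w measure \<Rightarrow> (nat \<Rightarrow> 'w \<Rightarrow> 'a::real_normed_vector) \<Rightarrow> 'a \<Rightarrow> real" where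
  "g1 M X x = prob_space.expectation M (\<lambda>\<omega>. norm (x + X 2 \<omega>)) - theta0 M X"

definition g2 :: "'w measure \<Rightarrow> (nat \<Rightarrow> 'w \<Rightarrow> 'a::real_normed_vector) \<Rightarrow> 'a \<Rightarrow> real" where
  "g2 M X x = prob_space.expectation M (\<lambda>\<omega>. norm (x - X 2 \<omega>)) - theta0 M X"

text \<open>
  \<open>0 < Var Z < \<infinity>\<close>. The integrability clause expresses finiteness, since the library's
  variance is \<open>0\<close> when the squared deviation is not integrable.
\<close>

definition pos_finite_variance :: "'w measure \<Rightarrow> ('w \<Rightarrow> real) \<Rightarrow> bool" where
  "pos_finite_variance M Z \<longleftrightarrow>
     integrable M (\<lambda>\<omega>. (Z \<omega> - prob_space.expectation M Z)\<^sup>2) \<and>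
     0 < prob_space.variance M Z"


section \<open>Chi-square quantiles\<close>

definition chi_square_1 :: "real measure" where
  "chi_square_1 = distr std_normal_distribution borel (\<lambda>x. x\<^sup>2)"

definition quantile :: "real measure \<Rightarrow> real \<Rightarrow> real" where
  "quantile \<mu> u = Inf {x. u \<le> cdf \<mu> x}"

end

(*
  Idea. Every solution of the Lagrange equations is a saddle point, so for all multipliers a1, a2
  with n1 * a1 + n2 * a2 = 0 the value of l is at least
  2 * sum ln (1 + a1 * V1 i) + 2 * sum ln (1 + a2 * V2 j). With a1 = d / n1 and a2 = - d / n2 this is
  about 2 * d * (U1 - U2), since the pseudo-values average to the U-statistics. The U-statistics
  concentrate at E|X1 + X2| and E|X1 - X2| by Chebyshev's inequality (condition C1 forces E|X1|^2 to be
  finite, because g2 x >= |x| - const), so l exceeds any given bound as soon as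
  E|X1 + X2| > E|X1 - X2|, for d large enough.

  For this strict inequality write |u| as a mixture over r > 0 of 1 - exp (- |u|^2 / r^2), and
  exp (- |x - y|^2 / r^2) as an integral over z of a product of Gaussians centred at z. The difference
  of the two expectations becomes an integral of (G_r z - G_r (- z))^2, where G_r is the Gaussian
  smoothing of F. If it is not positive, then G_r is even for arbitrarily small r, and F is symmetric.
*)
theory Submission
  imports Defs
begin

text \<open>The dual bound holds for every sample, and trivially when the Lagrange equations have no
  solution, since the statistic is then infinite. With multipliers of order 1/n the quadratic error
  of the logarithms is of order 1/n with high probability, so only the linear term survives. Two
  obstacles shape the rest. The statistic is defined through an existential over (lam1, lam2,
  \<theta>), while \<open>prob\<close> is 0 on a set that is not an event; measurability of the
  rejection event must therefore be proved before any estimate of its probability. In the energy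
  inequality, a Gaussian kernel is not integrable over all scales r, because it tends to 1 as r
  grows. Exchanging the integrals over r and over the sample is therefore done for 1 minus a kernel,
  which is nonnegative and has a finite integral once E|X1| is finite. Equality in the energy
  inequality gives evenness of the smoothed measure for almost every scale only. This is enough: a
  sequence of good scales tending to 0 recovers the measure in the weak sense.\<close>

section \<open>The energy inequality\<close>

text \<open>The functions \<open>min 1 (k * infdist x (- U))\<close> increase to the indicator of an
  open \<open>U\<close>, and the open sets are an intersection-stable generator of the Borel sets.
  Test functions with values in [0, 1] are dominated by the constant 1.\<close>

lemma finite_measure_eqI_bounded_continuous:
  fixes \<mu> \<nu> :: "'a::metric_space measure"
  assumes "finite_measure \<mu>" "finite_measure \<nu>" and [measurable_cong]: "sets \<mu> = sets borel" "sets \<nu> = sets borel"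
    and eq: "\<And>f::'a \<Rightarrow> real. continuous_on UNIV f \<Longrightarrow> (\<And>x. 0 \<le> f x \<and> f x \<le> 1)
        \<Longrightarrow> (\<integral>x. f x \<partial>\<mu>) = (\<integral>x. f x \<partial>\<nu>)"
  shows "\<mu> = \<nu>"
proof -
  interpret \<mu>: finite_measure \<mu> by fact
  interpret \<nu>: finite_measure \<nu> by fact
  have open_eq: "measure \<mu> U = measure \<nu> U" if U: "open U" for U :: "'a set"
  \<comment> \<open>\<open>infdist x {}\<close> is 0 by convention, so the approximation of the
    indicator fails when the complement of \<open>U\<close> is empty.\<close>
  proof (cases "U = UNIV")
    case True
    have "(\<integral>x. 1 \<partial>\<mu>) = (\<integral>x. (1::real) \<partial>\<nu>)" by (rule eq) auto
    moreover have "space \<mu> = UNIV" "space \<nu> = UNIV"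
      using assms(3,4) by (auto dest: sets_eq_imp_space_eq)
    ultimately show ?thesis using True by simp
  next
    case False
    define f where "f k x = min 1 (real k * infdist x (- U))" for k x
    have cont: "continuous_on UNIV (f k)" for k
      unfolding f_def by (intro continuous_intros)
    have f01: "0 \<le> f k x \<and> f k x \<le> 1" for k x
      unfolding f_def by (simp add: infdist_nonneg)
    have [measurable]: "f k \<in> borel_measurable borel" for k
      by (rule borel_measurable_continuous_onI[OF cont])
    have lim: "(\<lambda>k. f k x) \<longlonglongrightarrow> indicator U x" for x
    proof (cases "x \<in> U")
      case False
      then show ?thesis by (simp add: f_def)
    next
      case True
      have pos: "infdist x (- U) > 0"
        using infdist_pos_not_in_closed[of "- U" x] U True \<open>U \<noteq> UNIV\<close> by auto
      have "eventually (\<lambda>k. f k x = 1) sequentially"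
        using eventually_ge_at_top[of "nat \<lceil>1 / infdist x (- U)\<rceil>"]
      proof eventually_elim
        case (elim k)
        then have "1 / infdist x (- U) \<le> real k" by linarith
        then have "1 \<le> real k * infdist x (- U)" using pos by (simp add: field_simps)
        then show ?case by (simp add: f_def)
      qed
      then show ?thesis using True by (simp add: tendsto_eventually)
    qed
    have 1: "(\<lambda>k. \<integral>x. f k x \<partial>\<mu>) \<longlonglongrightarrow> (\<integral>x. indicator U x \<partial>\<mu>)"
      by (rule integral_dominated_convergence[where w="\<lambda>_. 1"])
        (use U lim f01 in \<open>auto intro!: borel_measurable_indicator\<close>)
    have 2: "(\<lambda>k. \<integral>x. f k x \<partial>\<nu>) \<longlonglongrightarrow> (\<integral>x. indicator U x \<partial>\<nu>)"
      by (rule integral_dominated_convergence[where w="\<lambda>_. 1"])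
        (use U lim f01 in \<open>auto intro!: borel_measurable_indicator\<close>)
    have "(\<integral>x. indicator U x \<partial>\<mu>) = (\<integral>x. indicator U x \<partial>\<nu> :: real)"
      using LIMSEQ_unique[OF 1] 2 eq[OF cont f01] by simp
    then show ?thesis using U assms(3,4) by simp
  qed
  show ?thesis
  proof (rule measure_eqI_generator_eq[where \<Omega>=UNIV and E="{S. open S}" and A="\<lambda>_. UNIV"])
    show "emeasure \<mu> X = emeasure \<nu> X" if "X \<in> {S. open S}" for X
      using open_eq[of X] that by (simp add: \<mu>.emeasure_eq_measure \<nu>.emeasure_eq_measure)
  qed (use assms(3,4) in \<open>auto simp: Int_stable_def borel_def\<close>)
qed

section \<open>Affine substitution and Gaussian integrals on Euclidean space\<close>

lemma
  fixes f :: "'a::euclidean_space \<Rightarrow> 'b::{banach, second_countable_topology}"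
  assumes c: "c \<noteq> 0"
  shows lborel_integrable_affine: "integrable lborel f \<Longrightarrow> integrable lborel (\<lambda>x. f (t + c *\<^sub>R x))"
    and lborel_integral_affine: "f \<in> borel_measurable borel \<Longrightarrow>
      (\<integral>x. f x \<partial>lborel) = \<bar>c\<bar> ^ DIM('a) *\<^sub>R (\<integral>x. f (t + c *\<^sub>R x) \<partial>lborel)"
proof -
  show "integrable lborel (\<lambda>x. f (t + c *\<^sub>R x))" if f: "integrable lborel f"
  proof -
    have [measurable]: "f \<in> borel_measurable borel" using f by simp
    have "integrable (density (distr lborel borel (\<lambda>x. t + c *\<^sub>R x)) (\<lambda>_. ennreal (\<bar>c\<bar>^DIM('a)))) f"
      using f lborel_affine[OF c, of t] by simp
    then have "integrable lborel (\<lambda>x. \<bar>c\<bar> ^ DIM('a) *\<^sub>R f (t + c *\<^sub>R x))"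
      using c by (subst (asm) integrable_density) (auto simp: integrable_distr_eq)
    from integrable_scaleR_right[OF this, of "inverse (\<bar>c\<bar> ^ DIM('a))"] show ?thesis
      using c by simp
  qed
  show "(\<integral>x. f x \<partial>lborel) = \<bar>c\<bar> ^ DIM('a) *\<^sub>R (\<integral>x. f (t + c *\<^sub>R x) \<partial>lborel)"
    if [measurable]: "f \<in> borel_measurable borel"
    by (subst lborel_affine[OF c, of t]) (simp add: integral_density integral_distr)
qed

text \<open>The Gaussian factors over the coordinates, and each factor is a multiple of a
  one-dimensional normal density.\<close>

lemma integrable_gaussian:
  assumes "0 < c"
  shows "integrable lborel (\<lambda>x::'a::euclidean_space. exp (- (c * (norm x)\<^sup>2)))"
proof (rule integrableI_nonneg)
  have prod: "exp (- (c * (norm x)\<^sup>2)) = (\<Prod>b\<in>Basis. exp (- (c * (x \<bullet> b)\<^sup>2)))" for x :: 'a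
  proof -
    have "(norm x)\<^sup>2 = (\<Sum>b\<in>Basis. (x \<bullet> b)\<^sup>2)"
      by (subst power2_norm_eq_inner, subst euclidean_inner) (simp add: power2_eq_square)
    then show ?thesis
      by (simp add: exp_sum[symmetric] sum_distrib_left sum_negf)
  qed
  \<comment> \<open>The standard deviation solves 1 / (2 * s^2) = c.\<close>
  define s where "s = sqrt (1 / (2 * c))"
  have s: "s > 0" "s\<^sup>2 = 1 / (2 * c)" using assms by (auto simp: s_def)
  have "integrable lborel (\<lambda>t. sqrt (2 * pi * s\<^sup>2) * normal_density 0 s t)"
    using s by (intro integrable_mult_right) simp
  also have "(\<lambda>t. sqrt (2 * pi * s\<^sup>2) * normal_density 0 s t) = (\<lambda>t. exp (- (c * t\<^sup>2)))"
    using s assms by (auto simp: normal_density_def fun_eq_iff field_simps)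
  finally have int: "integrable lborel (\<lambda>t::real. exp (- (c * t\<^sup>2)))" .
  have "(\<integral>\<^sup>+x. ennreal (exp (- (c * (norm (x::'a))\<^sup>2))) \<partial>lborel)
      = (\<integral>\<^sup>+x. (\<Prod>b\<in>Basis. ennreal (exp (- (c * (x \<bullet> b)\<^sup>2)))) \<partial>(lborel::'a measure))"
    by (simp add: prod prod_ennreal[symmetric])
  also have "\<dots> = (\<Prod>b\<in>(Basis::'a set). \<integral>\<^sup>+t. ennreal (exp (- (c * t\<^sup>2))) \<partial>lborel)"
    by (rule nn_integral_lborel_prod) auto
  also have "\<dots> < \<infinity>"
    using int by (auto simp: integrable_iff_bounded power_less_top_ennreal)
  finally show "(\<integral>\<^sup>+x. ennreal (exp (- (c * (norm (x::'a))\<^sup>2))) \<partial>lborel) < \<infinity>" .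
qed auto

definition gauss_kernel :: "real \<Rightarrow> 'a::real_normed_vector \<Rightarrow> 'a \<Rightarrow> real" where
  "gauss_kernel c x y = exp (- (c * (norm (x - y))\<^sup>2))"

lemma gauss_kernel_nonneg [simp]: "0 \<le> gauss_kernel c x y"
  and gauss_kernel_le_1: "0 \<le> c \<Longrightarrow> gauss_kernel c x y \<le> 1"
  and gauss_kernel_minus: "gauss_kernel c (- x) (- y) = gauss_kernel c x y"
  by (simp_all add: gauss_kernel_def norm_minus_commute)

lemma gauss_kernel_minus_left: "gauss_kernel c (- x) y = gauss_kernel c x (- y)"
  using gauss_kernel_minus[of c x "- y"] by simp

lemma measurable_gauss_kernel [measurable (raw)]:
  fixes f g :: "'b \<Rightarrow> 'a::euclidean_space"
  assumes [measurable]: "f \<in> borel_measurable M" "g \<in> borel_measurable M"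
  shows "(\<lambda>x. gauss_kernel c (f x) (g x)) \<in> borel_measurable M"
  unfolding gauss_kernel_def by measurable

text \<open>In dimension d this is pi / c to the power d / 2; it enters the argument through its
  positivity.\<close>

definition gauss_mass :: "'a::euclidean_space itself \<Rightarrow> real \<Rightarrow> real" where
  "gauss_mass _ c = (\<integral>z. exp (- (c * (norm z)\<^sup>2)) \<partial>(lborel::'a measure))"

lemma gauss_mass_pos:
  assumes "0 < c"
  shows "0 < gauss_mass TYPE('a::euclidean_space) c"
proof -
  have "gauss_mass TYPE('a) c \<noteq> 0"
  proof
    assume "gauss_mass TYPE('a) c = 0"
    then have "AE z::'a in lborel. exp (- (c * (norm z)\<^sup>2)) = 0"
      unfolding gauss_mass_def
      by (subst (asm) integral_nonneg_eq_0_iff_AE) (use integrable_gaussian[OF assms] in auto)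
    then have "AE z::'a in lborel. False" by simp
    then have "emeasure lborel (UNIV :: 'a set) = 0"
      by (simp add: eventually_False ae_filter_eq_bot_iff)
    then show False by simp
  qed
  moreover have "0 \<le> gauss_mass TYPE('a) c"
    unfolding gauss_mass_def by (rule integral_nonneg_AE) simp
  ultimately show ?thesis by simp
qed

text \<open>Completing the square at the midpoint of \<open>x\<close> and \<open>y\<close>
  (parallelogram law). The rate is halved in x - y and doubled in z, which is where c / 2 and 2 * c
  come from below.\<close>

lemma gauss_kernel_mult:
  fixes x y z :: "'a::euclidean_space"
  shows "gauss_kernel c x z * gauss_kernel c y z =
    gauss_kernel (c / 2) x y * exp (- (2 * c * (norm (z - (1/2) *\<^sub>R (x + y)))\<^sup>2))"
proof -
  have "(norm (x - z))\<^sup>2 + (norm (y - z))\<^sup>2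
      = (norm (x - y))\<^sup>2 / 2 + 2 * (norm (z - (1/2) *\<^sub>R (x + y)))\<^sup>2"
    by (simp add: power2_norm_eq_inner inner_diff_left inner_diff_right inner_add_left inner_add_right
        inner_commute field_simps)
  then have "c * (norm (x - z))\<^sup>2 + c * (norm (y - z))\<^sup>2
      = c / 2 * (norm (x - y))\<^sup>2 + 2 * c * (norm (z - (1/2) *\<^sub>R (x + y)))\<^sup>2"
    by (simp add: algebra_simps flip: distrib_left)
  then show ?thesis
    unfolding gauss_kernel_def exp_add[symmetric] by (simp add: algebra_simps)
qed

text \<open>Integrating out z exhibits the kernel of rate c / 2 as an L2 inner product of
  \<open>gauss_kernel c x\<close> and \<open>gauss_kernel c y\<close>. This is the source of all
  positivity in the energy inequality.\<close>

lemma
  fixes x y :: "'a::euclidean_space"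
  assumes c: "0 < c"
  shows integrable_gauss_kernel_mult: "integrable lborel (\<lambda>z. gauss_kernel c x z * gauss_kernel c y z)"
    and integral_gauss_kernel_mult: "(\<integral>z. gauss_kernel c x z * gauss_kernel c y z \<partial>lborel)
      = gauss_mass TYPE('a) (2 * c) * gauss_kernel (c / 2) x y"
proof -
  let ?u = "(1/2) *\<^sub>R (x + y)"
  have i: "integrable lborel (\<lambda>z::'a. exp (- (2 * c * (norm z)\<^sup>2)))"
    by (rule integrable_gaussian) (use c in simp)
  have "integrable lborel (\<lambda>z. exp (- (2 * c * (norm (z - ?u))\<^sup>2)))"
    using lborel_integrable_affine[where c=1 and t="- ?u", OF _ i] by (simp add: algebra_simps)
  then show "integrable lborel (\<lambda>z. gauss_kernel c x z * gauss_kernel c y z)"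
    unfolding gauss_kernel_mult by (rule integrable_mult_right)
  have "gauss_mass TYPE('a) (2 * c) = (\<integral>z. exp (- (2 * c * (norm (z - ?u))\<^sup>2)) \<partial>lborel)"
    unfolding gauss_mass_def
    by (subst lborel_integral_affine[where c=1 and t="- ?u"]) (simp_all add: algebra_simps)
  then show "(\<integral>z. gauss_kernel c x z * gauss_kernel c y z \<partial>lborel)
      = gauss_mass TYPE('a) (2 * c) * gauss_kernel (c / 2) x y"
    unfolding gauss_kernel_mult by simp
qed

section \<open>Gaussian smoothing and its odd part\<close>

definition gauss_smooth :: "real \<Rightarrow> 'a::euclidean_space measure \<Rightarrow> 'a \<Rightarrow> real" where
  "gauss_smooth c \<mu> z = (\<integral>x. gauss_kernel c x z \<partial>\<mu>)"

lemma (in prob_space) integrable_gauss_kernel: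
  assumes "f \<in> borel_measurable M" "g \<in> borel_measurable M" "0 \<le> c"
  shows "integrable M (\<lambda>x. gauss_kernel c (f x) (g x :: 'b::euclidean_space))"
  by (rule integrable_const_bound[where B=1]) (use assms in \<open>auto simp: gauss_kernel_le_1\<close>)

text \<open>\<open>(H z)\<^sup>2\<close> is the mean of \<open>a x z * a y z\<close> over two
  independent points x and y; Fubini then allows z to be integrated out first. Of the four resulting
  kernels two pairs coincide, because the kernel is invariant under changing both signs; hence the
  factor 2. The left side is a square, so the difference of kernels has nonnegative mean.\<close>

lemma integral_gauss_kernel_antisym:
  fixes \<mu> :: "'a::euclidean_space measure"
  assumes "prob_space \<mu>" and [measurable_cong]: "sets \<mu> = sets borel" and c: "0 < c"
  defines "H \<equiv> \<lambda>z. gauss_smooth c \<mu> z - gauss_smooth c \<mu> (- z)"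
  shows "integrable lborel (\<lambda>z. (H z)\<^sup>2)"
    and "(\<integral>z. (H z)\<^sup>2 \<partial>lborel) = 2 * gauss_mass TYPE('a) (2 * c) *
      (\<integral>p. (gauss_kernel (c / 2) (fst p) (snd p) - gauss_kernel (c / 2) (fst p) (- snd p)) \<partial>(\<mu> \<Otimes>\<^sub>M \<mu>))"
proof -
  interpret \<mu>: prob_space \<mu> by fact
  interpret \<mu>\<mu>: pair_prob_space \<mu> \<mu> ..
  interpret P: pair_sigma_finite "\<mu> \<Otimes>\<^sub>M \<mu>" "lborel :: 'a measure" ..
  let ?K = "gauss_mass TYPE('a) (2 * c)"
  let ?k = "gauss_kernel c" and ?k2 = "gauss_kernel (c / 2)"
  define a where "a x z = ?k x z - ?k x (- z)" for x z :: 'a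
  have [measurable]: "(\<lambda>p. a (f p) (g p)) \<in> borel_measurable N"
    if [measurable]: "f \<in> borel_measurable N" "g \<in> borel_measurable N" for f g :: "'b \<Rightarrow> 'a" and N
    unfolding a_def by measurable
  have K: "?K > 0" using c by (intro gauss_mass_pos) simp
  have H: "H z = (\<integral>x. a x z \<partial>\<mu>)" for z
    unfolding H_def gauss_smooth_def a_def
    by (rule Bochner_Integration.integral_diff[symmetric])
      (use c in \<open>auto intro!: \<mu>.integrable_gauss_kernel\<close>)
  have a_int: "integrable \<mu> (\<lambda>x. a x z)" for z
    unfolding a_def by (rule Bochner_Integration.integrable_diff)
      (use c in \<open>auto intro!: \<mu>.integrable_gauss_kernel\<close>)
  \<comment> \<open>With s and t equal to 1 or -1 this covers all four products in the expansion of
    \<open>a x z * a y z\<close>. Fubini applies because integrating out z leaves a bounded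
    kernel.\<close>
  have basic: "integrable ((\<mu> \<Otimes>\<^sub>M \<mu>) \<Otimes>\<^sub>M lborel) (\<lambda>(p, z). ?k (s *\<^sub>R fst p) z * ?k (t *\<^sub>R snd p) z)" for s t :: real
  proof (rule P.Fubini_integrable)
    show "(\<lambda>(p, z). ?k (s *\<^sub>R fst p) z * ?k (t *\<^sub>R snd p) z) \<in> borel_measurable ((\<mu> \<Otimes>\<^sub>M \<mu>) \<Otimes>\<^sub>M lborel)"
      by measurable
    show "AE p in \<mu> \<Otimes>\<^sub>M \<mu>. integrable lborel (\<lambda>z. case (p, z) of (p, z) \<Rightarrow> ?k (s *\<^sub>R fst p) z * ?k (t *\<^sub>R snd p) z)"
      using c by (simp add: integrable_gauss_kernel_mult)
    show "integrable (\<mu> \<Otimes>\<^sub>M \<mu>) (\<lambda>p. \<integral>z. norm (case (p, z) of (p, z) \<Rightarrow> ?k (s *\<^sub>R fst p) z * ?k (t *\<^sub>R snd p) z) \<partial>lborel)"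
      using c by (simp add: abs_mult integral_gauss_kernel_mult)
        (intro disjI2 \<mu>\<mu>.integrable_gauss_kernel; simp)
  qed
  have decomp: "a x z * a y z = ?k x z * ?k y z - ?k x z * ?k (- y) z - ?k (- x) z * ?k y z
      + ?k (- x) z * ?k (- y) z" for x y z
    unfolding a_def gauss_kernel_minus_left[symmetric] by (simp add: algebra_simps)
  have int: "integrable ((\<mu> \<Otimes>\<^sub>M \<mu>) \<Otimes>\<^sub>M lborel) (\<lambda>(p, z). a (fst p) z * a (snd p) z)"
  proof -
    have "integrable ((\<mu> \<Otimes>\<^sub>M \<mu>) \<Otimes>\<^sub>M lborel) (\<lambda>q.
        (\<lambda>(p, z). ?k (1 *\<^sub>R fst p) z * ?k (1 *\<^sub>R snd p) z) q
      - (\<lambda>(p, z). ?k (1 *\<^sub>R fst p) z * ?k ((-1) *\<^sub>R snd p) z) q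
      - (\<lambda>(p, z). ?k ((-1) *\<^sub>R fst p) z * ?k (1 *\<^sub>R snd p) z) q
      + (\<lambda>(p, z). ?k ((-1) *\<^sub>R fst p) z * ?k ((-1) *\<^sub>R snd p) z) q)"
      by (intro Bochner_Integration.integrable_add Bochner_Integration.integrable_diff basic)
    then show ?thesis by (simp add: decomp case_prod_unfold)
  qed
  have zint: "(\<integral>z. a x z * a y z \<partial>lborel) = 2 * ?K * (?k2 x y - ?k2 x (- y))" for x y
    unfolding decomp using c
    by (simp add: integrable_gauss_kernel_mult integral_gauss_kernel_mult)
      (simp add: gauss_kernel_minus gauss_kernel_minus_left algebra_simps)
  have pint: "(\<integral>p. a (fst p) z * a (snd p) z \<partial>(\<mu> \<Otimes>\<^sub>M \<mu>)) = (H z)\<^sup>2" for z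
  proof -
    have "integrable (\<mu> \<Otimes>\<^sub>M \<mu>) (\<lambda>p. a (fst p) z * a (snd p) z)"
    proof (rule \<mu>\<mu>.integrable_const_bound[where B=4])
      have "\<bar>a x z\<bar> \<le> 2" for x
        using gauss_kernel_le_1[of c x z] gauss_kernel_le_1[of c x "-z"] gauss_kernel_nonneg[of c x z]
          gauss_kernel_nonneg[of c x "-z"] c unfolding a_def by linarith
      then have "\<bar>a x z\<bar> * \<bar>a y z\<bar> \<le> 2 * 2" for x y by (intro mult_mono) auto
      then show "AE p in \<mu> \<Otimes>\<^sub>M \<mu>. norm (a (fst p) z * a (snd p) z) \<le> 4" by (simp add: abs_mult)
    qed measurable
    then have "(\<integral>p. a (fst p) z * a (snd p) z \<partial>(\<mu> \<Otimes>\<^sub>M \<mu>)) = (\<integral>x. (\<integral>y. a x z * a y z \<partial>\<mu>) \<partial>\<mu>)"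
      by (subst \<mu>\<mu>.integral_fst'[symmetric]) auto
    also have "\<dots> = (H z)\<^sup>2"
      by (simp add: H power2_eq_square)
    finally show ?thesis .
  qed
  have "integrable lborel (\<lambda>z. \<integral>p. a (fst p) z * a (snd p) z \<partial>(\<mu> \<Otimes>\<^sub>M \<mu>))"
    by (rule P.integrable_snd[OF int])
  then show "integrable lborel (\<lambda>z. (H z)\<^sup>2)" by (simp add: pint)
  have "(\<integral>z. (H z)\<^sup>2 \<partial>lborel) = (\<integral>z. (\<integral>p. a (fst p) z * a (snd p) z \<partial>(\<mu> \<Otimes>\<^sub>M \<mu>)) \<partial>lborel)"
    by (simp add: pint)
  also have "\<dots> = (\<integral>p. (\<integral>z. a (fst p) z * a (snd p) z \<partial>lborel) \<partial>(\<mu> \<Otimes>\<^sub>M \<mu>))"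
    using P.integral_snd[OF int] P.integral_fst[OF int] by simp
  also have "\<dots> = 2 * ?K * (\<integral>p. ?k2 (fst p) (snd p) - ?k2 (fst p) (- snd p) \<partial>(\<mu> \<Otimes>\<^sub>M \<mu>))"
    by (simp add: zint)
  finally show "(\<integral>z. (H z)\<^sup>2 \<partial>lborel) = 2 * ?K * (\<integral>p. ?k2 (fst p) (snd p) - ?k2 (fst p) (- snd p) \<partial>(\<mu> \<Otimes>\<^sub>M \<mu>))" .
qed

section \<open>The norm as a mixture of Gaussian kernels\<close>

definition riesz_profile :: "real \<Rightarrow> real" where
  "riesz_profile v = indicator {0<..} v * (1 - exp (- (1 / v\<^sup>2)))"

lemma measurable_riesz_profile [measurable]: "riesz_profile \<in> borel_measurable borel"
  unfolding riesz_profile_def by measurable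

lemma riesz_profile_nonneg: "0 \<le> riesz_profile v"
  by (simp add: riesz_profile_def)

text \<open>The profile is at most 1, and at most 1 / v^2 because 1 - exp (- u) \<le> u. The
  function 2 / (1 + v^2) dominates the first bound for v \<le> 1 and the second for v > 1.\<close>

lemma integrable_riesz_profile: "integrable lborel riesz_profile"
proof (rule Bochner_Integration.integrable_bound)
  have "integrable lborel (\<lambda>v. indicator {0<..} v *\<^sub>R (1 / (1 + v\<^sup>2)) :: real)"
    using integrable_I0i_1_div_plus_square
    by (simp add: interval_lebesgue_integrable_def set_integrable_def einterval_def zero_ereal_def greaterThan_def)
  then show "integrable lborel (\<lambda>v. 2 * (indicator {0<..} v *\<^sub>R (1 / (1 + v\<^sup>2))) :: real)"
    by (rule integrable_mult_right)
  show "AE v in lborel. norm (riesz_profile v) \<le> norm (2 * (indicator {0<..} v *\<^sub>R (1 / (1 + v\<^sup>2))) :: real)"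
  proof (rule AE_I2)
    fix v :: real
    have "1 - exp (- (1 / v\<^sup>2)) \<le> 2 / (1 + v\<^sup>2)" if "0 < v"
    proof (cases "v \<le> 1")
      case True
      have "v\<^sup>2 \<le> 1" using True that by (simp add: power_le_one)
      then have "1 \<le> 2 / (1 + v\<^sup>2)" by (simp add: field_simps add_pos_nonneg)
      then show ?thesis using exp_gt_zero[of "- (1 / v\<^sup>2)"] by linarith
    next
      case False
      then have v: "1 \<le> v\<^sup>2" by (simp add: one_le_power)
      have "1 - exp (- (1 / v\<^sup>2)) \<le> 1 / v\<^sup>2" using exp_ge_add_one_self[of "- (1 / v\<^sup>2)"] by linarith
      also have "1 / v\<^sup>2 = 2 / (2 * v\<^sup>2)" by simp
      also have "\<dots> \<le> 2 / (1 + v\<^sup>2)" using v by (intro divide_left_mono mult_pos_pos add_pos_nonneg; linarith)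
      finally show ?thesis .
    qed
    then show "norm (riesz_profile v) \<le> norm (2 * (indicator {0<..} v *\<^sub>R (1 / (1 + v\<^sup>2))) :: real)"
      by (auto simp: riesz_profile_def split: split_indicator)
  qed
qed measurable

text \<open>The value is the square root of pi; it is the sign that matters below.\<close>

definition riesz_const :: real where
  "riesz_const = (\<integral>v. riesz_profile v \<partial>lborel)"

lemma riesz_const_pos: "0 < riesz_const"
proof -
  have "(\<integral>v. indicator {0<..1::real} v * (1 - exp (- 1)) \<partial>lborel) \<le> riesz_const"
    unfolding riesz_const_def
  proof (rule Bochner_Integration.integral_mono[OF _ integrable_riesz_profile])
    show "integrable lborel (\<lambda>v::real. indicator {0<..1} v * (1 - exp (- 1) :: real))"
      by (intro integrable_mult_left) (simp add: integrable_indicator_iff)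
    fix v :: real
    show "indicator {0<..1} v * (1 - exp (- 1)) \<le> riesz_profile v"
    proof (cases "v \<in> {0<..1}")
      case True
      then have "v\<^sup>2 \<le> 1" by (simp add: power_le_one)
      then have "1 \<le> 1 / v\<^sup>2" using True by (simp add: field_simps)
      then show ?thesis using True by (simp add: riesz_profile_def)
    qed (simp add: riesz_profile_nonneg)
  qed
  moreover have "(\<integral>v. indicator {0<..1::real} v * (1 - exp (- 1)) \<partial>lborel) = 1 - exp (- 1 :: real)"
    by simp
  moreover have "1 - exp (- 1 :: real) > 0" by simp
  ultimately show ?thesis by linarith
qed

text \<open>Substituting \<open>r = norm (x - y) * v\<close> writes the norm as a mixture of Gaussian kernels.\<close>

lemma
  fixes x y :: "'a::euclidean_space"
  shows integrable_riesz: "integrable lborel (\<lambda>r. indicator {0<..} r * (1 - gauss_kernel (1 / r\<^sup>2) x y))"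
    and integral_riesz: "(\<integral>r. indicator {0<..} r * (1 - gauss_kernel (1 / r\<^sup>2) x y) \<partial>lborel)
      = riesz_const * norm (x - y)"
proof -
  define t where "t = norm (x - y)"
  have t: "t \<ge> 0" by (simp add: t_def)
  have eq: "indicator {0<..} r * (1 - gauss_kernel (1 / r\<^sup>2) x y) = riesz_profile (r / t)" if "t > 0" for r
    using that by (auto simp: gauss_kernel_def riesz_profile_def t_def[symmetric] zero_less_divide_iff
        power_divide split: split_indicator)
  have 0: "gauss_kernel c x y = 1" if "t = 0" for c
    using that by (simp add: t_def gauss_kernel_def)
  show "integrable lborel (\<lambda>r. indicator {0<..} r * (1 - gauss_kernel (1 / r\<^sup>2) x y))"
  proof (cases "t = 0")
    case False
    with t have "t > 0" by simp
    with lborel_integrable_real_affine[OF integrable_riesz_profile, of "1/t" 0] show ?thesis by (simp add: eq)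
  qed (simp add: 0)
  show "(\<integral>r. indicator {0<..} r * (1 - gauss_kernel (1 / r\<^sup>2) x y) \<partial>lborel) = riesz_const * norm (x - y)"
  proof (cases "t = 0")
    case False
    with t have "t > 0" by simp
    then have "(\<integral>r. riesz_profile (r / t) \<partial>lborel) = t * riesz_const"
      unfolding riesz_const_def by (subst lborel_integral_real_affine[where c=t and t=0]) simp_all
    with \<open>t > 0\<close> show ?thesis by (simp add: eq t_def)
  qed (use 0 in \<open>simp add: t_def\<close>)
qed

text \<open>Approximate identity: substituting \<tau> x + r z for z turns the left side into the
  mean of f (\<tau> x + r z) against a fixed Gaussian weight, and dominated convergence lets r tend
  to 0. The map \<tau> is there so that the identity treats \<open>\<mu>\<close> and negation treats
  its reflection.\<close>

lemma gauss_smoothing_limit: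
  fixes \<mu> :: "'a::euclidean_space measure" and f :: "'a \<Rightarrow> real"
  assumes "prob_space \<mu>" and [measurable_cong]: "sets \<mu> = sets borel"
    and [measurable]: "\<tau> \<in> borel_measurable borel"
    and cont: "continuous_on UNIV f" and f01: "\<And>x. 0 \<le> f x \<and> f x \<le> 1"
    and r: "\<And>k. 0 < r k" "r \<longlonglongrightarrow> 0"
  shows "(\<lambda>k. (1 / r k ^ DIM('a)) * (\<integral>z. f z * (\<integral>x. gauss_kernel (2 / (r k)\<^sup>2) (\<tau> x) z \<partial>\<mu>) \<partial>lborel))
      \<longlonglongrightarrow> gauss_mass TYPE('a) 2 * (\<integral>x. f (\<tau> x) \<partial>\<mu>)"
proof -
  interpret \<mu>: prob_space \<mu> by fact
  interpret P: pair_sigma_finite \<mu> "lborel :: 'a measure" ..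
  have [measurable]: "f \<in> borel_measurable borel"
    by (rule borel_measurable_continuous_onI[OF cont])
  define w where "w z = exp (- (2 * (norm z)\<^sup>2))" for z :: 'a
  have [measurable]: "w \<in> borel_measurable borel" unfolding w_def by measurable
  have w: "integrable lborel w" unfolding w_def by (rule integrable_gaussian) simp
  have w0: "w z \<ge> 0" for z by (simp add: w_def)
  have wint: "(\<integral>z. w z \<partial>lborel) = gauss_mass TYPE('a) 2"
    by (simp add: gauss_mass_def w_def)
  have pw: "integrable (\<mu> \<Otimes>\<^sub>M lborel) (\<lambda>(x, z). w z)"
    by (rule P.Fubini_integrable) (use w in \<open>simp_all\<close>)
  \<comment> \<open>At rate 2 / s^2 the substitution produces the weight \<open>w\<close>, which is
    free of s, and the Jacobian s^d cancels the normalisation.\<close>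
  have step: "(1 / s ^ DIM('a)) * (\<integral>z. f z * (\<integral>x. gauss_kernel (2 / s\<^sup>2) (\<tau> x) z \<partial>\<mu>) \<partial>lborel)
      = (\<integral>(x, z). f (\<tau> x + s *\<^sub>R z) * w z \<partial>(\<mu> \<Otimes>\<^sub>M lborel))" if s: "s > 0" for s
  proof -
    let ?k = "gauss_kernel (2 / s\<^sup>2) :: 'a \<Rightarrow> _"
    have k: "?k x (x + s *\<^sub>R z) = w z" for x z
      using s by (simp add: gauss_kernel_def w_def power_mult_distrib)
    have kx: "integrable lborel (\<lambda>z. ?k x z)" "(\<integral>z. ?k x z \<partial>lborel) = s ^ DIM('a) * gauss_mass TYPE('a) 2" for x
    proof -
      have i: "integrable lborel (\<lambda>z::'a. exp (- (2 / s\<^sup>2 * (norm z)\<^sup>2)))"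
        by (rule integrable_gaussian) (use s in simp)
      show "integrable lborel (\<lambda>z. ?k x z)"
        using lborel_integrable_affine[where c=1 and t="- x", OF _ i]
        by (simp add: gauss_kernel_def norm_minus_commute)
      show "(\<integral>z. ?k x z \<partial>lborel) = s ^ DIM('a) * gauss_mass TYPE('a) 2"
        by (subst lborel_integral_affine[where c=s and t=x]) (use s in \<open>auto simp: k wint\<close>)
    qed
    have int: "integrable (\<mu> \<Otimes>\<^sub>M lborel) (\<lambda>(x, z). f z * ?k (\<tau> x) z)"
    proof (rule Bochner_Integration.integrable_bound)
      show "integrable (\<mu> \<Otimes>\<^sub>M lborel) (\<lambda>(x, z). ?k (\<tau> x) z)"
        by (rule P.Fubini_integrable) (simp_all add: kx)
      show "AE p in \<mu> \<Otimes>\<^sub>M lborel. norm (case p of (x, z) \<Rightarrow> f z * ?k (\<tau> x) z) \<le> norm (case p of (x, z) \<Rightarrow> ?k (\<tau> x) z)"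
        using f01 by (intro AE_I2) (auto simp: abs_mult intro!: mult_left_le_one_le)
    qed measurable
    have "(\<integral>z. f z * (\<integral>x. ?k (\<tau> x) z \<partial>\<mu>) \<partial>lborel) = (\<integral>z. (\<integral>x. f z * ?k (\<tau> x) z \<partial>\<mu>) \<partial>lborel)"
      by simp
    also have "\<dots> = (\<integral>x. (\<integral>z. f z * ?k (\<tau> x) z \<partial>lborel) \<partial>\<mu>)"
      using P.integral_fst[OF int] P.integral_snd[OF int] by simp
    also have "(\<lambda>x. \<integral>z. f z * ?k (\<tau> x) z \<partial>lborel) = (\<lambda>x. s ^ DIM('a) * (\<integral>z. f (\<tau> x + s *\<^sub>R z) * w z \<partial>lborel))"
    proof
      fix x
      show "(\<integral>z. f z * ?k (\<tau> x) z \<partial>lborel) = s ^ DIM('a) * (\<integral>z. f (\<tau> x + s *\<^sub>R z) * w z \<partial>lborel)"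
        by (subst lborel_integral_affine[where c=s and t="\<tau> x"]) (use s in \<open>simp_all add: k\<close>)
    qed
    finally have 1: "(1 / s ^ DIM('a)) * (\<integral>z. f z * (\<integral>x. ?k (\<tau> x) z \<partial>\<mu>) \<partial>lborel)
        = (\<integral>x. (\<integral>z. f (\<tau> x + s *\<^sub>R z) * w z \<partial>lborel) \<partial>\<mu>)"
      using s by simp
    have "integrable (\<mu> \<Otimes>\<^sub>M lborel) (\<lambda>(x, z). f (\<tau> x + s *\<^sub>R z) * w z)"
      by (rule Bochner_Integration.integrable_bound[OF pw])
        (use f01 w0 in \<open>auto simp: abs_mult intro!: AE_I2 mult_left_le_one_le\<close>)
    from P.integral_fst[OF this] 1 show ?thesis by simp
  qed
  have "(\<lambda>k. \<integral>(x, z). f (\<tau> x + r k *\<^sub>R z) * w z \<partial>(\<mu> \<Otimes>\<^sub>M lborel)) \<longlonglongrightarrow> (\<integral>(x, z). f (\<tau> x) * w z \<partial>(\<mu> \<Otimes>\<^sub>M lborel))"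
  proof (rule integral_dominated_convergence[OF _ _ pw])
    show "AE p in \<mu> \<Otimes>\<^sub>M lborel. (\<lambda>k. case p of (x, z) \<Rightarrow> f (\<tau> x + r k *\<^sub>R z) * w z) \<longlonglongrightarrow> (case p of (x, z) \<Rightarrow> f (\<tau> x) * w z)"
    proof (rule AE_I2, clarsimp)
      fix x z
      have "(\<lambda>k. \<tau> x + r k *\<^sub>R z) \<longlonglongrightarrow> \<tau> x + 0 *\<^sub>R z"
        by (intro tendsto_intros r)
      then have "(\<lambda>k. f (\<tau> x + r k *\<^sub>R z)) \<longlonglongrightarrow> f (\<tau> x)"
        using cont by (auto intro!: isCont_tendsto_compose[where g=f] simp: continuous_on_eq_continuous_at)
      then show "(\<lambda>k. f (\<tau> x + r k *\<^sub>R z) * w z) \<longlonglongrightarrow> f (\<tau> x) * w z"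
        by (intro tendsto_intros)
    qed
    show "AE p in \<mu> \<Otimes>\<^sub>M lborel. norm (case p of (x, z) \<Rightarrow> f (\<tau> x + r k *\<^sub>R z) * w z) \<le> (case p of (x, z) \<Rightarrow> w z)" for k
      using f01 w0 by (auto simp: abs_mult intro!: AE_I2 mult_left_le_one_le)
  qed measurable
  also have "(\<integral>(x, z). f (\<tau> x) * w z \<partial>(\<mu> \<Otimes>\<^sub>M lborel)) = (\<integral>x. (\<integral>z. f (\<tau> x) * w z \<partial>lborel) \<partial>\<mu>)"
    by (rule P.integral_fst[symmetric], rule Bochner_Integration.integrable_bound[OF pw])
      (use f01 w0 in \<open>auto simp: abs_mult intro!: AE_I2 mult_left_le_one_le\<close>)
  also have "\<dots> = gauss_mass TYPE('a) 2 * (\<integral>x. f (\<tau> x) \<partial>\<mu>)"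
    by (simp add: wint mult.commute)
  finally show ?thesis
    by (simp only: step[OF r(1)])
qed

text \<open>Subtracting the mixture formulas for (x, y) and (x, - y) cancels the constant 1 and
  leaves the two kernels. Fubini is justified for each formula separately: its integrand is
  nonnegative, and its integral over r is a multiple of a norm that is integrable over the
  sample.\<close>

lemma integral_gauss_kernel_diff:
  fixes \<mu> :: "'a::euclidean_space measure"
  assumes "prob_space \<mu>" and [measurable_cong]: "sets \<mu> = sets borel"
    and norm: "integrable \<mu> norm"
  defines "D \<equiv> \<lambda>r. \<integral>p. (gauss_kernel (1 / r\<^sup>2) (fst p) (snd p) - gauss_kernel (1 / r\<^sup>2) (fst p) (- snd p)) \<partial>(\<mu> \<Otimes>\<^sub>M \<mu>)"
  shows "integrable lborel (\<lambda>r. indicator {0<..} r * D r)"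
    and "(\<integral>r. indicator {0<..} r * D r \<partial>lborel) =
      riesz_const * (\<integral>p. norm (fst p + snd p) - norm (fst p - snd p) \<partial>(\<mu> \<Otimes>\<^sub>M \<mu>))"
    and "integrable (\<mu> \<Otimes>\<^sub>M \<mu>) (\<lambda>p. norm (fst p + snd p))" (is ?int1)
    and "integrable (\<mu> \<Otimes>\<^sub>M \<mu>) (\<lambda>p. norm (fst p - snd p))" (is ?int2)
proof -
  interpret \<mu>: prob_space \<mu> by fact
  interpret \<mu>\<mu>: pair_prob_space \<mu> \<mu> ..
  interpret P: pair_sigma_finite "\<mu> \<Otimes>\<^sub>M \<mu>" "lborel :: real measure" ..
  have fst: "integrable (\<mu> \<Otimes>\<^sub>M \<mu>) (\<lambda>p. norm (fst p))"
    by (rule \<mu>\<mu>.Fubini_integrable) (use norm in simp_all)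
  have snd: "integrable (\<mu> \<Otimes>\<^sub>M \<mu>) (\<lambda>p. norm (snd p))"
    by (rule \<mu>\<mu>.Fubini_integrable) (use norm in simp_all)
  have fs: "integrable (\<mu> \<Otimes>\<^sub>M \<mu>) (\<lambda>p. norm (fst p) + norm (snd p))"
    by (intro Bochner_Integration.integrable_add fst snd)
  show int1: ?int1
    by (rule Bochner_Integration.integrable_bound[OF fs]) (auto intro!: AE_I2 norm_triangle_ineq)
  show int2: ?int2
    by (rule Bochner_Integration.integrable_bound[OF fs]) (auto intro!: AE_I2 norm_triangle_ineq4)
  \<comment> \<open>The value s = 1 belongs to norm (x - y), and s = -1 to norm (x + y).\<close>
  define A where "A s = (\<lambda>(p :: 'a \<times> 'a, r). indicator {0<..} r * (1 - gauss_kernel (1 / r\<^sup>2) (fst p) (s *\<^sub>R snd p)))" for s :: real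
  have [measurable]: "A s \<in> borel_measurable ((\<mu> \<Otimes>\<^sub>M \<mu>) \<Otimes>\<^sub>M lborel)" for s
    unfolding A_def gauss_kernel_def by measurable
  have A0: "A s q \<ge> 0" for s q
    unfolding A_def by (auto split: split_indicator prod.split simp: gauss_kernel_le_1)
  have Aint: "integrable ((\<mu> \<Otimes>\<^sub>M \<mu>) \<Otimes>\<^sub>M lborel) (A s)" if s: "s = 1 \<or> s = - 1" for s
  proof (rule P.Fubini_integrable)
    show "AE p in \<mu> \<Otimes>\<^sub>M \<mu>. integrable lborel (\<lambda>r. A s (p, r))"
      by (simp add: A_def integrable_riesz)
    have "(\<integral>r. norm (A s (p, r)) \<partial>lborel) = riesz_const * norm (fst p - s *\<^sub>R snd p)" for p
      using A0 by (simp add: abs_of_nonneg) (simp add: A_def integral_riesz)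
    then show "integrable (\<mu> \<Otimes>\<^sub>M \<mu>) (\<lambda>p. \<integral>r. norm (A s (p, r)) \<partial>lborel)"
      using s int1 int2 by auto
  qed measurable
  define B where "B = (\<lambda>(p, r). A (-1) (p, r) - A 1 (p, r))"
  have B: "B = (\<lambda>(p, r). indicator {0<..} r * (gauss_kernel (1 / r\<^sup>2) (fst p) (snd p) - gauss_kernel (1 / r\<^sup>2) (fst p) (- snd p)))"
    by (auto simp: B_def A_def algebra_simps)
  have Bint: "integrable ((\<mu> \<Otimes>\<^sub>M \<mu>) \<Otimes>\<^sub>M lborel) (\<lambda>(p, r). B (p, r))"
    unfolding B_def using Bochner_Integration.integrable_diff[OF Aint Aint, of "-1" 1] by (simp add: case_prod_unfold)
  have BD: "(\<integral>p. B (p, r) \<partial>(\<mu> \<Otimes>\<^sub>M \<mu>)) = indicator {0<..} r * D r" for r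
    by (simp add: B D_def)
  show "integrable lborel (\<lambda>r. indicator {0<..} r * D r)"
    using P.integrable_snd[OF Bint] by (simp add: BD)
  have "(\<integral>r. indicator {0<..} r * D r \<partial>lborel) = (\<integral>r. (\<integral>p. B (p, r) \<partial>(\<mu> \<Otimes>\<^sub>M \<mu>)) \<partial>lborel)"
    by (simp add: BD)
  also have "\<dots> = (\<integral>p. (\<integral>r. B (p, r) \<partial>lborel) \<partial>(\<mu> \<Otimes>\<^sub>M \<mu>))"
    using P.integral_snd[OF Bint] P.integral_fst[OF Bint] by simp
  also have "(\<lambda>p. \<integral>r. B (p, r) \<partial>lborel) = (\<lambda>p. riesz_const * (norm (fst p + snd p) - norm (fst p - snd p)))"
    by (simp add: B_def A_def integrable_riesz integral_riesz) (simp add: algebra_simps)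
  finally show "(\<integral>r. indicator {0<..} r * D r \<partial>lborel) =
      riesz_const * (\<integral>p. norm (fst p + snd p) - norm (fst p - snd p) \<partial>(\<mu> \<Otimes>\<^sub>M \<mu>))"
    by simp
qed

lemma norm_sum_gt_norm_diff:
  fixes \<mu> :: "'a::euclidean_space measure"
  assumes prob: "prob_space \<mu>" and sets[measurable_cong]: "sets \<mu> = sets borel"
    and norm: "integrable \<mu> norm" and asym: "\<mu> \<noteq> distr \<mu> borel uminus"
  shows "(\<integral>p. norm (fst p - snd p) \<partial>(\<mu> \<Otimes>\<^sub>M \<mu>)) < (\<integral>p. norm (fst p + snd p) \<partial>(\<mu> \<Otimes>\<^sub>M \<mu>))"
proof (rule ccontr)
  interpret \<mu>: prob_space \<mu> by fact
  define D where "D r = (\<integral>p. (gauss_kernel (1 / r\<^sup>2) (fst p) (snd p) - gauss_kernel (1 / r\<^sup>2) (fst p) (- snd p)) \<partial>(\<mu> \<Otimes>\<^sub>M \<mu>))" for r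
  define H where "H r z = gauss_smooth (2 / r\<^sup>2) \<mu> z - gauss_smooth (2 / r\<^sup>2) \<mu> (- z)" for r z
  note aux = integral_gauss_kernel_diff[OF prob sets norm, folded D_def]
  assume "\<not> ?thesis"
  then have "(\<integral>p. norm (fst p + snd p) - norm (fst p - snd p) \<partial>(\<mu> \<Otimes>\<^sub>M \<mu>)) \<le> 0"
    by (subst Bochner_Integration.integral_diff[OF aux(3,4)]) simp
  then have le: "(\<integral>r. indicator {0<..} r * D r \<partial>lborel) \<le> 0"
    unfolding aux(2) using riesz_const_pos by (simp add: mult_le_0_iff)
  \<comment> \<open>The rate 2 / r^2 is halved to the 1 / r^2 of \<open>D\<close> and doubled to the
    4 / r^2 of the mass.\<close>
  have HD: "integrable lborel (\<lambda>z. (H r z)\<^sup>2)"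
    "(\<integral>z. (H r z)\<^sup>2 \<partial>lborel) = 2 * gauss_mass TYPE('a) (4 / r\<^sup>2) * D r" if "r > 0" for r
    using integral_gauss_kernel_antisym[OF prob sets, of "2 / r\<^sup>2"] that
    by (simp_all add: H_def D_def)
  have Dnn: "D r \<ge> 0" if "r > 0" for r
  proof -
    have "0 \<le> 2 * gauss_mass TYPE('a) (4 / r\<^sup>2) * D r"
      unfolding HD(2)[OF that, symmetric] by (intro integral_nonneg_AE) simp
    moreover have "0 < 2 * gauss_mass TYPE('a) (4 / r\<^sup>2)"
      using gauss_mass_pos[of "4 / r\<^sup>2"] that by simp
    ultimately show ?thesis by (simp add: zero_le_mult_iff)
  qed
  have nn: "AE r in lborel. 0 \<le> indicator {0<..} r * D r"
    using Dnn by (auto intro!: AE_I2 split: split_indicator)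
  have "(\<integral>r. indicator {0<..} r * D r \<partial>lborel) = 0"
    using le integral_nonneg_AE[OF nn] by simp
  then have AE0: "AE r in lborel. indicator {0<..} r * D r = 0"
    using integral_nonneg_eq_0_iff_AE[OF aux(1) nn] by simp
  \<comment> \<open>\<open>D\<close> vanishes outside a null set, and an interval of positive length
    is not null; so zeros of \<open>D\<close> accumulate at 0.\<close>
  have "\<exists>r. 0 < r \<and> r < 1 / real (Suc k) \<and> D r = 0" for k
  proof (rule ccontr)
    assume *: "\<not> ?thesis"
    from AE0 have "AE r in lborel. r \<notin> {0<..<1 / real (Suc k)}"
      by eventually_elim (use * in \<open>auto split: split_indicator_asm\<close>)
    then have "{0<..<1 / real (Suc k)} \<in> null_sets lborel"
      by (subst AE_iff_null_sets) auto
    then show False by (simp add: null_sets_def)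
  qed
  then obtain r where r: "\<And>k. 0 < r k" "\<And>k. r k < 1 / real (Suc k)" "\<And>k. D (r k) = 0"
    by metis
  have r0: "r \<longlonglongrightarrow> 0"
    by (rule tendsto_sandwich[OF _ _ tendsto_const LIMSEQ_inverse_real_of_nat])
      (use r in \<open>auto intro!: always_eventually less_imp_le simp: inverse_eq_divide\<close>)
  have "\<mu> = distr \<mu> borel uminus"
  proof (rule finite_measure_eqI_bounded_continuous)
    show "finite_measure \<mu>" "finite_measure (distr \<mu> borel uminus)"
      using \<mu>.prob_space_distr[of uminus borel] by (auto simp: prob_space_def)
    fix f :: "'a \<Rightarrow> real" assume cont: "continuous_on UNIV f" and f01: "\<And>x. 0 \<le> f x \<and> f x \<le> 1"
    have [measurable]: "f \<in> borel_measurable borel"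
      by (rule borel_measurable_continuous_onI[OF cont])
    \<comment> \<open>A vanishing integral of \<open>(H (r k) z)\<^sup>2\<close> yields equality for
      almost every z, which suffices under the Lebesgue integral against \<open>f\<close>.\<close>
    have Heq: "AE z in lborel. (\<integral>x. gauss_kernel (2 / (r k)\<^sup>2) x z \<partial>\<mu>)
        = (\<integral>x. gauss_kernel (2 / (r k)\<^sup>2) (- x) z \<partial>\<mu>)" for k
    proof -
      have "(\<integral>z. (H (r k) z)\<^sup>2 \<partial>lborel) = 0" using HD(2)[OF r(1)[of k]] r(3) by simp
      then have "AE z in lborel. (H (r k) z)\<^sup>2 = 0"
        using integral_nonneg_eq_0_iff_AE[OF HD(1)[OF r(1)]] by simp
      then show ?thesis
        by eventually_elim (simp add: H_def gauss_smooth_def gauss_kernel_minus_left)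
    qed
    have mm: "(\<lambda>z. \<integral>x. gauss_kernel c (\<tau> x) z \<partial>\<mu>) \<in> borel_measurable lborel"
      if [measurable]: "\<tau> \<in> borel_measurable borel" for c and \<tau> :: "'a \<Rightarrow> 'a"
      by measurable
    have eq: "(\<integral>z. f z * (\<integral>x. gauss_kernel (2 / (r k)\<^sup>2) x z \<partial>\<mu>) \<partial>lborel)
        = (\<integral>z. f z * (\<integral>x. gauss_kernel (2 / (r k)\<^sup>2) (- x) z \<partial>\<mu>) \<partial>lborel)" for k
      by (rule integral_cong_AE) (use Heq[of k] mm[of "\<lambda>x. x"] mm[of uminus] in auto)
    \<comment> \<open>By \<open>eq\<close> the smoothed integrals for \<open>\<mu>\<close> and for
      its reflection form the same sequence, so their limits agree.\<close>
    have "gauss_mass TYPE('a) 2 * (\<integral>x. f x \<partial>\<mu>) = gauss_mass TYPE('a) 2 * (\<integral>x. f (- x) \<partial>\<mu>)"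
      by (rule LIMSEQ_unique[OF gauss_smoothing_limit[OF prob sets _ cont f01 r(1) r0, of "\<lambda>x. x"]])
        (use gauss_smoothing_limit[OF prob sets _ cont f01 r(1) r0, of uminus] eq in auto)
    then have "(\<integral>x. f x \<partial>\<mu>) = (\<integral>x. f (- x) \<partial>\<mu>)"
      using gauss_mass_pos[of 2, where 'a='a] by simp
    then show "(\<integral>x. f x \<partial>\<mu>) = (\<integral>x. f x \<partial>distr \<mu> borel uminus)"
      by (simp add: integral_distr)
  qed (use sets in auto)
  with asym show False by contradiction
qed

section \<open>Jackknife pseudo-values\<close>

abbreviation less_pairs :: "'i::ord set \<Rightarrow> ('i \<times> 'i) set" where
  "less_pairs I \<equiv> {(k, j). k \<in> I \<and> j \<in> I \<and> k < j}"

lemma finite_less_pairs: "finite I \<Longrightarrow> finite (less_pairs I)"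
  by (rule finite_subset[of _ "I \<times> I"]) auto

lemma card_less_pairs:
  fixes I :: "nat set"
  assumes "finite I"
  shows "card (less_pairs I) = card I choose 2"
proof -
  have "bij_betw (\<lambda>(k, j). {k, j}) (less_pairs I) {S. S \<subseteq> I \<and> card S = 2}"
  proof (rule bij_betwI')
    fix x y assume "x \<in> less_pairs I" "y \<in> less_pairs I"
    then show "(case x of (k, j) \<Rightarrow> {k, j}) = (case y of (k, j) \<Rightarrow> {k, j}) \<longleftrightarrow> x = y"
      by (cases x, cases y) (auto simp: doubleton_eq_iff)
  next
    fix x assume "x \<in> less_pairs I"
    then show "(case x of (k, j) \<Rightarrow> {k, j}) \<in> {S. S \<subseteq> I \<and> card S = 2}"
      by (cases x) auto
  next
    fix S assume "S \<in> {S. S \<subseteq> I \<and> card S = 2}"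
    then obtain k j where S: "S = {k, j}" "k \<noteq> j" "k \<in> I" "j \<in> I" by (auto simp: card_2_iff)
    have "(min k j, max k j) \<in> less_pairs I" "S = {min k j, max k j}"
      using S by (auto simp: min_def max_def)
    then show "\<exists>x\<in>less_pairs I. S = (case x of (k, j) \<Rightarrow> {k, j})"
      by (intro bexI[of _ "(min k j, max k j)"]) simp_all
  qed
  then show ?thesis
    using assms by (simp add: bij_betw_same_card n_subsets)
qed

lemma real_choose_2: "real (n choose 2) = real n * (real n - 1) / 2"
  by (cases n) (simp_all add: choose_two real_of_nat_div algebra_simps)

text \<open>From m = 3 on, the binomial coefficient of m - 1 over 2 is nonzero, and the factors m
  and m - 1 cancel against the binomial coefficients.\<close>

lemma jack_pseudo_eq:
  assumes m: "3 \<le> m" and i: "i \<in> {1..m}"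
  shows "jack_pseudo h Z m i = 2 / (real m - 1) * (\<Sum>(k, j)\<in>less_pairs {1..m}. h (Z k) (Z j))
     - 2 / (real m - 2) * (\<Sum>(k, j)\<in>less_pairs ({1..m} - {i}). h (Z k) (Z j))"
proof -
  have r: "real m \<ge> 3" using m by simp
  have c: "card ({1..m} - {i}) = m - 1" using i by simp
  have "real m * ustat h Z {1..m} = 2 / (real m - 1) * (\<Sum>(k, j)\<in>less_pairs {1..m}. h (Z k) (Z j))"
    using r unfolding ustat_def by (simp add: real_choose_2 field_simps)
  moreover have "(real m - 1) * ustat h Z ({1..m} - {i}) = 2 / (real m - 2) * (\<Sum>(k, j)\<in>less_pairs ({1..m} - {i}). h (Z k) (Z j))"
    using r unfolding ustat_def c by (simp add: real_choose_2 of_nat_diff divide_simps)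
  ultimately show ?thesis unfolding jack_pseudo_def by simp
qed

text \<open>In a pair with k < j at most one entry equals \<open>i\<close>, so the two
  \<open>of_bool\<close> weights add up to 0 or 1 and select exactly the deleted pairs.\<close>

lemma sum_less_pairs_remove:
  fixes f :: "nat \<times> nat \<Rightarrow> real"
  assumes "finite I"
  shows "(\<Sum>p\<in>less_pairs (I - {i}). f p) =
    (\<Sum>p\<in>less_pairs I. f p) - (\<Sum>p\<in>less_pairs I. (of_bool (fst p = i) + of_bool (snd p = i)) * f p)"
proof -
  have "(\<Sum>p\<in>less_pairs (I - {i}). f p)
      = (\<Sum>p\<in>less_pairs I. if fst p \<noteq> i \<and> snd p \<noteq> i then f p else 0)"
    by (subst sum.inter_filter[symmetric, OF finite_less_pairs[OF assms]])
      (auto intro!: sum.cong)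
  also have "\<dots> = (\<Sum>p\<in>less_pairs I. f p - (of_bool (fst p = i) + of_bool (snd p = i)) * f p)"
    by (intro sum.cong refl) auto
  finally show ?thesis by (simp add: sum_subtractf)
qed

text \<open>Double counting: a pair is lost in two of the m deletions, so the leave-one-out sums
  total (m - 2) * S.\<close>

lemma sum_jack_pseudo:
  assumes m: "3 \<le> m"
  shows "(\<Sum>i=1..m. jack_pseudo h Z m i) = real m * ustat h Z {1..m}"
proof -
  have r: "real m \<ge> 3" using m by simp
  let ?f = "\<lambda>(k, j). h (Z k) (Z j)"
  let ?P = "less_pairs {1..m}"
  define S where "S = (\<Sum>p\<in>?P. ?f p)"
  have "(\<Sum>i=1..m. \<Sum>p\<in>?P. (of_bool (fst p = i) + of_bool (snd p = i)) * ?f p)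
      = (\<Sum>p\<in>?P. (\<Sum>i=1..m. of_bool (fst p = i) + of_bool (snd p = i)) * ?f p)"
    by (subst sum.swap) (simp add: sum_distrib_right)
  also have "\<dots> = (\<Sum>p\<in>?P. 2 * ?f p)"
  proof (intro sum.cong refl arg_cong2[where f="(*)"])
    fix p assume "p \<in> ?P"
    then show "(\<Sum>i=1..m. of_bool (fst p = i) + of_bool (snd p = i)) = (2::real)"
      by (auto simp: sum.distrib of_bool_def sum.delta)
  qed
  finally have "(\<Sum>i=1..m. \<Sum>p\<in>?P. (of_bool (fst p = i) + of_bool (snd p = i)) * ?f p) = 2 * S"
    by (simp add: S_def sum_distrib_left)
  then have rem: "(\<Sum>i=1..m. \<Sum>p\<in>less_pairs ({1..m} - {i}). ?f p) = real m * S - 2 * S"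
    by (subst sum_less_pairs_remove) (simp_all add: sum_subtractf S_def)
  define T where "T i = (\<Sum>p\<in>less_pairs ({1..m} - {i}). ?f p)" for i
  have "(\<Sum>i=1..m. jack_pseudo h Z m i) = (\<Sum>i=1..m. 2 / (real m - 1) * S - 2 / (real m - 2) * T i)"
    unfolding S_def T_def by (intro sum.cong refl jack_pseudo_eq m)
  also have "\<dots> = real m * (2 / (real m - 1) * S) - 2 / (real m - 2) * (\<Sum>i=1..m. T i)"
    by (simp only: sum_subtractf sum_distrib_left) simp
  also have "(\<Sum>i=1..m. T i) = real m * S - 2 * S"
    unfolding T_def by (rule rem)
  also have "real m * (2 / (real m - 1) * S) - 2 / (real m - 2) * (real m * S - 2 * S) =
      real m * (2 / (real m - 1) * S) - 2 * S"
    using r by (simp add: divide_simps) (simp add: algebra_simps)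
  also have "\<dots> = 2 / (real m - 1) * S"
    using r by (simp add: field_simps)
  also have "\<dots> = real m * ustat h Z {1..m}"
    using r unfolding ustat_def S_def by (simp add: real_choose_2 field_simps)
  finally show ?thesis .
qed

lemma square_sum_le: "(u + v)\<^sup>2 \<le> 2 * u\<^sup>2 + 2 * v\<^sup>2" for u v :: real
  using zero_le_power2[of "u - v"] by (simp add: power2_diff power2_sum)

text \<open>A pseudo-value is governed by \<open>R i\<close>, the sum over the pairs through i, with
  a small correction from the full sum \<open>S\<close>. Its size is thus \<open>a i\<close> plus
  the sample mean A / m, up to constants, and Cauchy-Schwarz handles the mean. The constant is 2088
  = 2 * 12^2 + 2 * 30^2.\<close>

lemma sum_square_jack_pseudo_le:
  fixes Z :: "nat \<Rightarrow> 'a::real_normed_vector"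
  assumes m: "3 \<le> m" and h: "\<And>x y. 0 \<le> h x y" "\<And>x y. h x y \<le> norm x + norm y"
  shows "(\<Sum>i=1..m. (jack_pseudo h Z m i)\<^sup>2) \<le> 2088 * (\<Sum>i=1..m. (norm (Z i))\<^sup>2)"
proof -
  have r: "real m \<ge> 3" using m by simp
  let ?f = "\<lambda>(k, j). h (Z k) (Z j)"
  let ?P = "less_pairs {1..m}" and ?I = "{1..m} \<times> {1..m}"
  define a where "a i = norm (Z i)" for i
  define A where "A = (\<Sum>i=1..m. a i)"
  define S where "S = (\<Sum>p\<in>?P. ?f p)"
  define R where "R i = (\<Sum>p\<in>?P. (of_bool (fst p = i) + of_bool (snd p = i)) * ?f p)" for i
  have a0: "a i \<ge> 0" for i by (simp add: a_def)
  have A0: "A \<ge> 0" unfolding A_def by (intro sum_nonneg a0)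
  have f0: "0 \<le> ?f p" for p using h(1) by (cases p) auto
  have S0: "0 \<le> S" unfolding S_def by (intro sum_nonneg f0)
  have R0: "0 \<le> R i" for i unfolding R_def by (intro sum_nonneg mult_nonneg_nonneg f0) auto
  have RS: "R i \<le> S" for i
    unfolding R_def S_def
    by (intro sum_mono mult_left_le_one_le f0) (auto simp: of_bool_def)
  have fle: "?f p \<le> a (fst p) + a (snd p)" for p using h(2) by (cases p) (auto simp: a_def)
  have PI: "?P \<subseteq> ?I" by auto
  have S_le: "S \<le> 2 * real m * A"
  proof -
    have "S \<le> (\<Sum>p\<in>?P. a (fst p) + a (snd p))" unfolding S_def by (intro sum_mono fle)
    also have "\<dots> \<le> (\<Sum>p\<in>?I. a (fst p) + a (snd p))"
      by (intro sum_mono2 PI) (auto intro: a0 add_nonneg_nonneg)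
    also have "\<dots> = 2 * real m * A"
      by (simp add: sum.cartesian_product' sum.distrib A_def sum_distrib_left[symmetric])
    finally show ?thesis .
  qed
  have R_le: "R i \<le> 2 * real m * a i + 2 * A" if "i \<in> {1..m}" for i
  proof -
    let ?w = "\<lambda>p. of_bool (fst p = i) + of_bool (snd p = i) :: real"
    have "R i \<le> (\<Sum>p\<in>?P. ?w p * (a (fst p) + a (snd p)))"
      unfolding R_def by (intro sum_mono mult_left_mono fle) auto
    also have "\<dots> \<le> (\<Sum>p\<in>?I. ?w p * (a (fst p) + a (snd p)))"
      by (intro sum_mono2 PI) (auto intro!: mult_nonneg_nonneg add_nonneg_nonneg a0)
    also have "\<dots> = (\<Sum>k=1..m. \<Sum>j=1..m. (if k = i then a k + a j else 0) + (if j = i then a k + a j else 0))"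
      by (subst sum.cartesian_product') (auto intro!: sum.cong simp: of_bool_def)
    also have "\<dots> = (\<Sum>j=1..m. \<Sum>k=1..m. if k = i then a k + a j else 0)
        + (\<Sum>k=1..m. \<Sum>j=1..m. if j = i then a k + a j else 0)"
      by (subst sum.swap) (simp only: sum.distrib)
    also have "\<dots> = (\<Sum>j=1..m. a i + a j) + (\<Sum>k=1..m. a k + a i)"
      using that by simp
    also have "\<dots> = 2 * real m * a i + 2 * A"
      using that by (simp add: sum.distrib A_def)
    finally show ?thesis .
  qed
  have V: "\<bar>jack_pseudo h Z m i\<bar> \<le> 12 * a i + 30 * (A / real m)" if i: "i \<in> {1..m}" for i
  proof -
    have "jack_pseudo h Z m i = 2 / (real m - 1) * S - 2 / (real m - 2) * (S - R i)"
      unfolding jack_pseudo_eq[OF m i] R_def S_def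
      by (subst sum_less_pairs_remove) simp_all
    also have "\<dots> = 2 / (real m - 2) * R i - 2 / ((real m - 1) * (real m - 2)) * S"
    proof -
      have "2 / ((real m - 1) * (real m - 2)) = 2 / (real m - 2) - 2 / (real m - 1)"
        using r by (simp add: divide_simps)
      then show ?thesis by (simp only: left_diff_distrib right_diff_distrib)
    qed
    finally have eq: "jack_pseudo h Z m i = 2 / (real m - 2) * R i - 2 / ((real m - 1) * (real m - 2)) * S" .
    have "\<bar>jack_pseudo h Z m i\<bar> \<le> 2 / (real m - 2) * R i + 2 / ((real m - 1) * (real m - 2)) * S"
      using r R0[of i] S0 unfolding eq by (intro order.trans[OF abs_triangle_ineq4]) (simp add: abs_mult)
    \<comment> \<open>Both replacements of m - 1 and m - 2 by multiples of m are equalities at m =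
      3, the worst case.\<close>
    also have "\<dots> \<le> 6 / real m * R i + 9 / (real m)\<^sup>2 * S"
    proof (intro add_mono mult_right_mono R0 S0)
      show "2 / (real m - 2) \<le> 6 / real m" using r by (simp add: field_simps)
      have "2 * (real m)\<^sup>2 \<le> 9 * ((real m - 1) * (real m - 2))"
      proof -
        \<comment> \<open>This product is 9 * (m - 1) * (m - 2) - 2 * m^2, factored at its root
          3.\<close>
        have "0 \<le> (real m - 3) * (7 * real m - 6)" using r by (intro mult_nonneg_nonneg) auto
        then show ?thesis by (simp add: algebra_simps power2_eq_square)
      qed
      then show "2 / ((real m - 1) * (real m - 2)) \<le> 9 / (real m)\<^sup>2"
        using r by (simp add: divide_simps mult_ac)
    qed
    also have "\<dots> \<le> 6 / real m * (2 * real m * a i + 2 * A) + 9 / (real m)\<^sup>2 * (2 * real m * A)"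
      using R_le[OF i] S_le by (intro add_mono mult_left_mono) auto
    also have "\<dots> = 12 * a i + 30 * (A / real m)"
      using r by (simp add: field_simps power2_eq_square)
    finally show ?thesis .
  qed
  have "(\<Sum>i=1..m. (jack_pseudo h Z m i)\<^sup>2) \<le> (\<Sum>i=1..m. 288 * (a i)\<^sup>2 + 1800 * (A / real m)\<^sup>2)"
  proof (rule sum_mono)
    fix i assume i: "i \<in> {1..m}"
    have "(jack_pseudo h Z m i)\<^sup>2 \<le> (12 * a i + 30 * (A / real m))\<^sup>2"
      using V[OF i] by (simp add: abs_le_square_iff[symmetric])
    also have "\<dots> \<le> 2 * (12 * a i)\<^sup>2 + 2 * (30 * (A / real m))\<^sup>2"
      by (rule square_sum_le)
    finally show "(jack_pseudo h Z m i)\<^sup>2 \<le> 288 * (a i)\<^sup>2 + 1800 * (A / real m)\<^sup>2"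
      by (simp only: power_mult_distrib) simp
  qed
  also have "\<dots> = 288 * (\<Sum>i=1..m. (a i)\<^sup>2) + 1800 * (A\<^sup>2 / real m)"
    using r by (simp add: sum.distrib sum_distrib_left[symmetric] power_divide power2_eq_square[of "real m"])
  also have "A\<^sup>2 / real m \<le> (\<Sum>i=1..m. (a i)\<^sup>2)"
  proof -
    have "A\<^sup>2 \<le> (\<Sum>i=1..m. (a i)\<^sup>2) * real m"
      unfolding A_def using Cauchy_Schwarz_ineq_sum[of a "\<lambda>_. 1" "{1..m}"] by simp
    then show ?thesis using r by (simp add: divide_le_eq)
  qed
  finally show ?thesis by (simp add: a_def)
qed

section \<open>The dual lower bound\<close>

text \<open>Weak duality. By concavity of the logarithm each sample contributes an error linear in
  \<theta> - t, and the balance condition cancels the two slopes. Any balanced multipliers with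
  positive denominators are admissible, whether or not they solve the other Lagrange
  equations.\<close>

lemma jel_value_ge:
  assumes s: "jel_solution V1 m1 V2 m2 lam1 lam2 \<theta>"
    and bal: "real m1 * a1 + real m2 * a2 = 0"
    and pos1: "\<forall>i\<in>{1..m1}. 0 < 1 + a1 * (V1 i - t)"
    and pos2: "\<forall>j\<in>{1..m2}. 0 < 1 + a2 * (V2 j - t)"
  shows "2 * (\<Sum>i=1..m1. ln (1 + a1 * (V1 i - t))) + 2 * (\<Sum>j=1..m2. ln (1 + a2 * (V2 j - t)))
    \<le> jel_value V1 m1 V2 m2 lam1 lam2 \<theta>"
proof -
  have 1: "(\<Sum>i=1..m1. ln (1 + a1 * (V1 i - t))) - (\<Sum>i=1..m1. ln (1 + lam1 * (V1 i - \<theta>)))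
         \<le> real m1 * a1 * (\<theta> - t)"
    by (intro sum_ln_weights_le; use s pos1 in \<open>simp add: jel_solution_def\<close>)
  have 2: "(\<Sum>j=1..m2. ln (1 + a2 * (V2 j - t))) - (\<Sum>j=1..m2. ln (1 + lam2 * (V2 j - \<theta>)))
         \<le> real m2 * a2 * (\<theta> - t)"
    by (intro sum_ln_weights_le; use s pos2 in \<open>simp add: jel_solution_def\<close>)
  have "real m1 * a1 * (\<theta> - t) + real m2 * a2 * (\<theta> - t) = (real m1 * a1 + real m2 * a2) * (\<theta> - t)"
    by (simp add: algebra_simps)
  with 1 2 bal show ?thesis
    by (simp add: jel_value_def)
qed

lemma jel_llr_solution:
  assumes "jel_solution V1 m1 V2 m2 lam1 lam2 \<theta>"
  shows "jel_llr V1 m1 V2 m2 = ereal (jel_value V1 m1 V2 m2 lam1 lam2 \<theta>)"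
proof -
  have "(THE l. \<exists>lam1 lam2 \<theta>. jel_solution V1 m1 V2 m2 lam1 lam2 \<theta> \<and>
      l = jel_value V1 m1 V2 m2 lam1 lam2 \<theta>) = jel_value V1 m1 V2 m2 lam1 lam2 \<theta>"
    using assms by (intro the_equality) (auto intro: jel_value_unique)
  then show ?thesis using assms unfolding jel_llr_def by auto
qed

text \<open>The value infinity for an empty solution set makes a finite upper bound an existence
  statement, the form needed for measurability.\<close>

lemma jel_llr_le_iff:
  "jel_llr V1 m1 V2 m2 \<le> ereal c \<longleftrightarrow>
    (\<exists>lam1 lam2 \<theta>. jel_solution V1 m1 V2 m2 lam1 lam2 \<theta> \<and> jel_value V1 m1 V2 m2 lam1 lam2 \<theta> \<le> c)"
proof
  assume le: "jel_llr V1 m1 V2 m2 \<le> ereal c"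
  then obtain lam1 lam2 \<theta> where s: "jel_solution V1 m1 V2 m2 lam1 lam2 \<theta>"
    unfolding jel_llr_def by (auto split: if_splits)
  with le show "\<exists>lam1 lam2 \<theta>. jel_solution V1 m1 V2 m2 lam1 lam2 \<theta> \<and> jel_value V1 m1 V2 m2 lam1 lam2 \<theta> \<le> c"
    using jel_llr_solution[OF s] by auto
next
  assume "\<exists>lam1 lam2 \<theta>. jel_solution V1 m1 V2 m2 lam1 lam2 \<theta> \<and> jel_value V1 m1 V2 m2 lam1 lam2 \<theta> \<le> c"
  then obtain lam1 lam2 \<theta> where "jel_solution V1 m1 V2 m2 lam1 lam2 \<theta>" "jel_value V1 m1 V2 m2 lam1 lam2 \<theta> \<le> c"
    by blast
  then show "jel_llr V1 m1 V2 m2 \<le> ereal c" by (simp add: jel_llr_solution)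
qed

text \<open>This inserts ln (1 + x) \<ge> x - 2 * x^2, valid for |x| \<le> 1/2, into the dual
  bound.\<close>

lemma jel_llr_ge:
  assumes bal: "real m1 * a1 + real m2 * a2 = 0"
    and small1: "\<forall>i\<in>{1..m1}. \<bar>a1 * (V1 i - t)\<bar> \<le> 1 / 2"
    and small2: "\<forall>j\<in>{1..m2}. \<bar>a2 * (V2 j - t)\<bar> \<le> 1 / 2"
  shows "ereal (2 * (a1 * ((\<Sum>i=1..m1. V1 i) - real m1 * t) - 2 * a1\<^sup>2 * (\<Sum>i=1..m1. (V1 i - t)\<^sup>2)) +
      2 * (a2 * ((\<Sum>j=1..m2. V2 j) - real m2 * t) - 2 * a2\<^sup>2 * (\<Sum>j=1..m2. (V2 j - t)\<^sup>2)))
    \<le> jel_llr V1 m1 V2 m2"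
proof -
  have lnsum: "a * ((\<Sum>i=1..m. V i) - real m * t) - 2 * a\<^sup>2 * (\<Sum>i=1..m. (V i - t)\<^sup>2)
      \<le> (\<Sum>i=1..m. ln (1 + a * (V i - t)))"
    if "\<forall>i\<in>{1..m}. \<bar>a * (V i - t)\<bar> \<le> 1 / 2" for a m and V :: "nat \<Rightarrow> real"
  proof -
    have "a * ((\<Sum>i=1..m. V i) - real m * t) - 2 * a\<^sup>2 * (\<Sum>i=1..m. (V i - t)\<^sup>2)
        = (\<Sum>i=1..m. a * (V i - t) - 2 * (a * (V i - t))\<^sup>2)"
      by (simp add: sum_subtractf power_mult_distrib mult.assoc flip: sum_distrib_left)
    also have "\<dots> \<le> (\<Sum>i=1..m. ln (1 + a * (V i - t)))"
    proof (rule sum_mono)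
      fix i assume "i \<in> {1..m}"
      from abs_ln_one_plus_x_minus_x_bound[OF bspec[OF that this]]
      show "a * (V i - t) - 2 * (a * (V i - t))\<^sup>2 \<le> ln (1 + a * (V i - t))" by linarith
    qed
    finally show ?thesis .
  qed
  show ?thesis
  proof (cases "\<exists>lam1 lam2 \<theta>. jel_solution V1 m1 V2 m2 lam1 lam2 \<theta>")
    case True
    then obtain lam1 lam2 \<theta> where s: "jel_solution V1 m1 V2 m2 lam1 lam2 \<theta>" by blast
    have "\<forall>i\<in>{1..m1}. 0 < 1 + a1 * (V1 i - t)" "\<forall>j\<in>{1..m2}. 0 < 1 + a2 * (V2 j - t)"
      using small1 small2 by (force simp: abs_le_iff)+
    note ge = jel_value_ge[OF s bal this]
    show ?thesis
      unfolding jel_llr_solution[OF s] ereal_less_eq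
      by (rule order.trans[OF _ ge]) (intro add_mono mult_left_mono lnsum small1 small2; simp)
  next
    case False
    then show ?thesis by (simp add: jel_llr_def)
  qed
qed

text \<open>
  The multipliers \<open>\<delta> / m1\<close> and \<open>- \<delta> / m2\<close> with a fixed \<open>\<delta>\<close> already suffice: the linear term of the
  dual bound is \<open>2 * \<delta> * (u1 - u2)\<close>, and the quadratic error is negligible because the pseudo-values
  have a sum of squares of order \<open>n\<close> only.
\<close>

lemma jel_llr_ge_gap:
  assumes k: "0 < k" "k \<le> real m1" "k \<le> real m2" and \<delta>: "0 \<le> \<delta>"
    and small: "(\<delta> / k)\<^sup>2 * ((\<Sum>i=1..m1. (V1 i)\<^sup>2) + (\<Sum>j=1..m2. (V2 j)\<^sup>2)) \<le> 1 / 4"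
    and u: "(\<Sum>i=1..m1. V1 i) = real m1 * u1" "(\<Sum>j=1..m2. V2 j) = real m2 * u2"
  shows "ereal (2 * \<delta> * (u1 - u2) - 1) \<le> jel_llr V1 m1 V2 m2"
proof -
  define a1 a2 where "a1 = \<delta> / real m1" and "a2 = - \<delta> / real m2"
  let ?S1 = "\<Sum>i=1..m1. (V1 i)\<^sup>2" and ?S2 = "\<Sum>j=1..m2. (V2 j)\<^sup>2"
  have m: "real m1 > 0" "real m2 > 0" using k by linarith+
  have S: "0 \<le> ?S1" "0 \<le> ?S2" by (intro sum_nonneg; simp)+
  have "\<bar>a1\<bar> \<le> \<delta> / k" "\<bar>a2\<bar> \<le> \<delta> / k"
    using k \<delta> m by (auto simp: a1_def a2_def intro!: divide_left_mono)
  then have a: "a1\<^sup>2 \<le> (\<delta> / k)\<^sup>2" "a2\<^sup>2 \<le> (\<delta> / k)\<^sup>2"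
    using k \<delta> by (auto simp flip: abs_le_square_iff)
  \<comment> \<open>This bound is used twice. A single square is at most the whole sum, so every
    argument has modulus at most 1/2; and the quadratic error is 4 times the left side, hence the
    loss of 1 in the conclusion.\<close>
  have b: "a1\<^sup>2 * ?S1 + a2\<^sup>2 * ?S2 \<le> 1 / 4"
  proof -
    have "a1\<^sup>2 * ?S1 + a2\<^sup>2 * ?S2 \<le> (\<delta> / k)\<^sup>2 * ?S1 + (\<delta> / k)\<^sup>2 * ?S2"
      using a S by (intro add_mono mult_right_mono) auto
    also have "\<dots> \<le> 1 / 4" using small by (simp only: distrib_left)
    finally show ?thesis .
  qed
  have nn: "0 \<le> a1\<^sup>2 * ?S1" "0 \<le> a2\<^sup>2 * ?S2" using S by auto
  have le: "\<bar>x\<bar> \<le> 1 / 2" if "x\<^sup>2 \<le> 1 / 4" for x :: real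
    using that abs_le_square_iff[of x "1/2"] by (simp add: power_divide)
  have s1: "\<bar>a1 * (V1 i - 0)\<bar> \<le> 1 / 2" if "i \<in> {1..m1}" for i
  proof (rule le)
    have "(V1 i)\<^sup>2 \<le> ?S1" using that by (intro member_le_sum) auto
    then have "a1\<^sup>2 * (V1 i)\<^sup>2 \<le> a1\<^sup>2 * ?S1" by (intro mult_left_mono) auto
    then show "(a1 * (V1 i - 0))\<^sup>2 \<le> 1 / 4" using b nn by (simp add: power_mult_distrib)
  qed
  have s2: "\<bar>a2 * (V2 j - 0)\<bar> \<le> 1 / 2" if "j \<in> {1..m2}" for j
  proof (rule le)
    have "(V2 j)\<^sup>2 \<le> ?S2" using that by (intro member_le_sum) auto
    then have "a2\<^sup>2 * (V2 j)\<^sup>2 \<le> a2\<^sup>2 * ?S2" by (intro mult_left_mono) auto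
    then show "(a2 * (V2 j - 0))\<^sup>2 \<le> 1 / 4" using b nn by (simp add: power_mult_distrib)
  qed
  have bal: "real m1 * a1 + real m2 * a2 = 0" using m by (simp add: a1_def a2_def)
  have au: "a1 * (real m1 * u1) = \<delta> * u1" "a2 * (real m2 * u2) = - \<delta> * u2"
    using m by (simp_all add: a1_def a2_def)
  have "2 * \<delta> * (u1 - u2) - 1
      \<le> 2 * (a1 * ((\<Sum>i=1..m1. V1 i) - real m1 * 0) - 2 * a1\<^sup>2 * (\<Sum>i=1..m1. (V1 i - 0)\<^sup>2)) +
        2 * (a2 * ((\<Sum>j=1..m2. V2 j) - real m2 * 0) - 2 * a2\<^sup>2 * (\<Sum>j=1..m2. (V2 j - 0)\<^sup>2))"
    using b unfolding u by (simp add: au right_diff_distrib)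
  also have "ereal \<dots> \<le> jel_llr V1 m1 V2 m2"
    by (rule jel_llr_ge[OF bal]; use s1 s2 in blast)
  finally show ?thesis by simp
qed

section \<open>Measurability of the likelihood ratio\<close>

text \<open>On a compact set a continuous nonnegative function has a zero exactly if its infimum is
  0, and the infimum can be taken over a countable dense subset. This replaces an uncountable union
  by countable operations.\<close>

lemma sets_exists_zero_compact:
  fixes G :: "'w \<Rightarrow> 'b::{metric_space, second_countable_topology} \<Rightarrow> real"
  assumes C: "compact C"
    and [measurable]: "\<And>y. y \<in> C \<Longrightarrow> (\<lambda>\<omega>. G \<omega> y) \<in> borel_measurable M"
    and cont: "\<And>\<omega>. continuous_on C (G \<omega>)"
    and nonneg: "\<And>\<omega> y. 0 \<le> G \<omega> y"
  shows "{\<omega> \<in> space M. \<exists>y\<in>C. G \<omega> y = 0} \<in> sets M"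
proof -
  obtain T where T: "countable T" "T \<subseteq> C" "C \<subseteq> closure T"
    using separable by blast
  have "(\<exists>y\<in>C. G \<omega> y = 0) \<longleftrightarrow> (\<forall>k::nat. \<exists>y\<in>T. G \<omega> y < 1 / Suc k)" for \<omega>
  proof
    assume "\<exists>y\<in>C. G \<omega> y = 0"
    then obtain y where y: "y \<in> C" "G \<omega> y = 0" by blast
    show "\<forall>k::nat. \<exists>y\<in>T. G \<omega> y < 1 / Suc k"
    proof
      fix k :: nat
      have "0 < 1 / real (Suc k)" by simp
      then obtain d where d: "0 < d" "\<And>z. z \<in> C \<Longrightarrow> dist z y < d \<Longrightarrow> dist (G \<omega> z) (G \<omega> y) < 1 / real (Suc k)"
        using cont[of \<omega>] y(1) unfolding continuous_on_iff by metis
      obtain z where "z \<in> T" "dist z y < d"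
        using T(3) y(1) d(1) closure_approachable by blast
      then show "\<exists>y\<in>T. G \<omega> y < 1 / Suc k"
        using d(2)[of z] T(2) y(2) by (auto intro!: bexI[of _ z] simp: dist_real_def)
    qed
  next
    assume *: "\<forall>k::nat. \<exists>y\<in>T. G \<omega> y < 1 / Suc k"
    then have "C \<noteq> {}" using T(2) by blast
    then obtain y where y: "y \<in> C" "\<And>z. z \<in> C \<Longrightarrow> G \<omega> y \<le> G \<omega> z"
      using continuous_attains_inf[OF C _ cont[of \<omega>]] by blast
    have "G \<omega> y \<le> 0"
    proof (rule field_le_epsilon)
      fix e :: real assume "0 < e"
      then obtain k :: nat where "1 / Suc k < e" by (metis nat_approx_posE)
      moreover obtain z where "z \<in> T" "G \<omega> z < 1 / Suc k" using * by blast
      ultimately show "G \<omega> y \<le> 0 + e" using y(2)[of z] T(2) by force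
    qed
    then show "\<exists>y\<in>C. G \<omega> y = 0" using y(1) nonneg[of \<omega> y] by (intro bexI[of _ y]) auto
  qed
  then have "{\<omega> \<in> space M. \<exists>y\<in>C. G \<omega> y = 0} = {\<omega> \<in> space M. \<forall>k::nat. \<exists>y\<in>T. G \<omega> y < 1 / Suc k}"
    by simp
  also have "\<dots> \<in> sets M"
  proof -
    have "{\<omega> \<in> space M. \<exists>y\<in>T. G \<omega> y < 1 / Suc k} \<in> sets M" for k :: nat
    proof (rule sets.sets_Collect_countable_Ex'[OF _ T(1)])
      fix y assume "y \<in> T"
      with T(2) have [measurable]: "(\<lambda>\<omega>. G \<omega> y) \<in> borel_measurable M" by auto
      show "{\<omega> \<in> space M. G \<omega> y < 1 / Suc k} \<in> sets M" by measurable
    qed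
    then show ?thesis by (rule sets.sets_Collect_countable_All)
  qed
  finally show ?thesis .
qed

text \<open>
  The event \<open>jel_llr \<le> c\<close> is a projection along \<open>(lam1, lam2, \<theta>)\<close>. It is measurable because the
  solution set is a countable union of compact pieces: on the \<open>K\<close>-th piece the parameters lie in
  \<open>cball 0 K\<close>, all denominators are at least \<open>1 / Suc K\<close>, and the defect, which is continuous thanks
  to the clipped denominators, vanishes exactly at the solutions of value at most \<open>c\<close>.
\<close>

definition clip_den :: "nat \<Rightarrow> real \<Rightarrow> real \<Rightarrow> real \<Rightarrow> real" where
  "clip_den K lam \<theta> v = max (1 / Suc K) (1 + lam * (v - \<theta>))"

definition jel_defect ::
    "nat \<Rightarrow> real \<Rightarrow> (nat \<Rightarrow> real) \<Rightarrow> nat \<Rightarrow> (nat \<Rightarrow> real) \<Rightarrow> nat \<Rightarrow> real \<times> real \<times> real \<Rightarrow> real" where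
  "jel_defect K c V1 m1 V2 m2 = (\<lambda>(lam1, lam2, \<theta>).
     (\<Sum>i=1..m1. max 0 (1 / Suc K - (1 + lam1 * (V1 i - \<theta>)))) +
     (\<Sum>j=1..m2. max 0 (1 / Suc K - (1 + lam2 * (V2 j - \<theta>)))) +
     \<bar>\<Sum>i=1..m1. (V1 i - \<theta>) / clip_den K lam1 \<theta> (V1 i)\<bar> +
     \<bar>\<Sum>j=1..m2. (V2 j - \<theta>) / clip_den K lam2 \<theta> (V2 j)\<bar> +
     \<bar>lam1 * (\<Sum>i=1..m1. -1 / clip_den K lam1 \<theta> (V1 i)) +
       lam2 * (\<Sum>j=1..m2. -1 / clip_den K lam2 \<theta> (V2 j))\<bar> +
     max 0 (2 * (\<Sum>i=1..m1. ln (clip_den K lam1 \<theta> (V1 i))) +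
       2 * (\<Sum>j=1..m2. ln (clip_den K lam2 \<theta> (V2 j))) - c))"

lemma clip_den_pos: "0 < clip_den K lam \<theta> v"
  by (simp add: clip_den_def less_max_iff_disj)

lemma clip_den_eq: "1 / Suc K \<le> 1 + lam * (v - \<theta>) \<Longrightarrow> clip_den K lam \<theta> v = 1 + lam * (v - \<theta>)"
  by (simp add: clip_den_def max_def)

lemma jel_defect_nonneg: "0 \<le> jel_defect K c V1 m1 V2 m2 y"
  unfolding jel_defect_def by (auto split: prod.split intro!: add_nonneg_nonneg sum_nonneg)

lemma continuous_on_clip_den:
  "continuous_on S f \<Longrightarrow> continuous_on S g \<Longrightarrow> continuous_on S (\<lambda>y. clip_den K (f y) (g y) v)"
  unfolding clip_den_def by (intro continuous_intros)

lemma continuous_jel_defect: "continuous_on S (jel_defect K c V1 m1 V2 m2)"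
  unfolding jel_defect_def case_prod_unfold
  by (intro continuous_intros continuous_on_clip_den ballI less_imp_neq[OF clip_den_pos, symmetric])

lemma measurable_jel_defect:
  assumes [measurable]: "\<And>i. (\<lambda>\<omega>. V1 \<omega> i) \<in> borel_measurable M" "\<And>i. (\<lambda>\<omega>. V2 \<omega> i) \<in> borel_measurable M"
  shows "(\<lambda>\<omega>. jel_defect K c (V1 \<omega>) m1 (V2 \<omega>) m2 y) \<in> borel_measurable M"
  unfolding jel_defect_def case_prod_unfold clip_den_def by measurable

text \<open>A sum of nonnegative terms vanishes only termwise. The first two terms then say that no
  denominator is clipped, so the clipped expressions in the others are the original ones.\<close>

lemma jel_defect_eq_0_iff:
  "jel_defect K c V1 m1 V2 m2 (lam1, lam2, \<theta>) = 0 \<longleftrightarrow>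
    jel_solution V1 m1 V2 m2 lam1 lam2 \<theta> \<and> jel_value V1 m1 V2 m2 lam1 lam2 \<theta> \<le> c \<and>
    (\<forall>i\<in>{1..m1}. 1 / Suc K \<le> 1 + lam1 * (V1 i - \<theta>)) \<and>
    (\<forall>j\<in>{1..m2}. 1 / Suc K \<le> 1 + lam2 * (V2 j - \<theta>))"
  (is "_ \<longleftrightarrow> ?sol \<and> ?val \<and> ?P1 \<and> ?P2")
proof -
  let ?d1 = "\<lambda>i. clip_den K lam1 \<theta> (V1 i)" and ?d2 = "\<lambda>j. clip_den K lam2 \<theta> (V2 j)"
  have sum0: "a + b + \<bar>e\<bar> + \<bar>f\<bar> + \<bar>g\<bar> + max 0 h = 0 \<longleftrightarrow> a = 0 \<and> b = 0 \<and> e = 0 \<and> f = 0 \<and> g = 0 \<and> h \<le> 0"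
    if "a \<ge> 0" "b \<ge> 0" for a b e f g h :: real
    using that by (auto simp: max_def)
  have z1: "(\<Sum>i=1..m. max 0 (1 / Suc K - (1 + a * (V i - \<theta>)))) = 0
      \<longleftrightarrow> (\<forall>i\<in>{1..m}. 1 / Suc K \<le> 1 + a * (V i - \<theta>))" for a m and V :: "nat \<Rightarrow> real"
  proof -
    have "max 0 x = 0 \<longleftrightarrow> x \<le> 0" for x :: real by (simp add: max_def)
    then show ?thesis
      by (subst sum_nonneg_eq_0_iff) (simp_all only: finite_atLeastAtMost max.cobounded1 diff_le_0_iff_le)
  qed
  have "jel_defect K c V1 m1 V2 m2 (lam1, lam2, \<theta>) = 0 \<longleftrightarrow> ?P1 \<and> ?P2 \<and>
      (\<Sum>i=1..m1. (V1 i - \<theta>) / ?d1 i) = 0 \<and> (\<Sum>j=1..m2. (V2 j - \<theta>) / ?d2 j) = 0 \<and>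
      lam1 * (\<Sum>i=1..m1. -1 / ?d1 i) + lam2 * (\<Sum>j=1..m2. -1 / ?d2 j) = 0 \<and>
      2 * (\<Sum>i=1..m1. ln (?d1 i)) + 2 * (\<Sum>j=1..m2. ln (?d2 j)) - c \<le> 0"
    unfolding jel_defect_def prod.case
    by (subst sum0) (auto intro!: sum_nonneg simp only: z1)
  also have "\<dots> \<longleftrightarrow> ?sol \<and> ?val \<and> ?P1 \<and> ?P2"
  proof (cases "?P1 \<and> ?P2")
    case True
    have p: "0 < 1 + a * (v - \<theta>)" if "1 / Suc K \<le> 1 + a * (v - \<theta>)" for a v
      using that by (rule less_le_trans[rotated]) simp
    have pos: "\<forall>i\<in>{1..m1}. 0 < 1 + lam1 * (V1 i - \<theta>)" "\<forall>j\<in>{1..m2}. 0 < 1 + lam2 * (V2 j - \<theta>)"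
      using True p by blast+
    have d: "(\<Sum>i=1..m1. F i (?d1 i)) = (\<Sum>i=1..m1. F i (1 + lam1 * (V1 i - \<theta>)))"
      "(\<Sum>j=1..m2. F j (?d2 j)) = (\<Sum>j=1..m2. F j (1 + lam2 * (V2 j - \<theta>)))" for F :: "nat \<Rightarrow> real \<Rightarrow> real"
      using True by (intro sum.cong refl; simp add: clip_den_eq)+
    show ?thesis
      unfolding jel_solution_def jel_value_def d(1)[of "\<lambda>_. ln"] d(2)[of "\<lambda>_. ln"]
        d(1)[of "\<lambda>_ x. - 1 / x"] d(2)[of "\<lambda>_ x. - 1 / x"]
        d(1)[of "\<lambda>i x. (V1 i - \<theta>) / x"] d(2)[of "\<lambda>j x. (V2 j - \<theta>) / x"] diff_le_0_iff_le
      using True pos by blast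
  qed auto
  finally show ?thesis .
qed

text \<open>A solution has finitely many denominators, all positive, so they stay above 1 / Suc K
  for all large K.\<close>

lemma ex_jel_defect_iff:
  "(\<exists>lam1 lam2 \<theta>. jel_solution V1 m1 V2 m2 lam1 lam2 \<theta> \<and> jel_value V1 m1 V2 m2 lam1 lam2 \<theta> \<le> c)
    \<longleftrightarrow> (\<exists>K. \<exists>y\<in>cball 0 (real K). jel_defect K c V1 m1 V2 m2 y = 0)"
proof
  assume "\<exists>lam1 lam2 \<theta>. jel_solution V1 m1 V2 m2 lam1 lam2 \<theta> \<and> jel_value V1 m1 V2 m2 lam1 lam2 \<theta> \<le> c"
  then obtain lam1 lam2 \<theta> where s: "jel_solution V1 m1 V2 m2 lam1 lam2 \<theta>"
      and c: "jel_value V1 m1 V2 m2 lam1 lam2 \<theta> \<le> c" by blast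
  have ev: "eventually (\<lambda>K. 1 / Suc K \<le> d) sequentially" if "0 < d" for d :: real
    using order_tendstoD(2)[OF LIMSEQ_inverse_real_of_nat that]
    by eventually_elim (simp add: inverse_eq_divide)
  have "eventually (\<lambda>K. norm (lam1, lam2, \<theta>) \<le> real K) sequentially"
    using filterlim_real_sequentially by (simp add: filterlim_at_top)
  moreover have "eventually (\<lambda>K. \<forall>i\<in>{1..m1}. 1 / Suc K \<le> 1 + lam1 * (V1 i - \<theta>)) sequentially"
    using s by (intro eventually_ball_finite ballI ev) (auto simp: jel_solution_def)
  moreover have "eventually (\<lambda>K. \<forall>j\<in>{1..m2}. 1 / Suc K \<le> 1 + lam2 * (V2 j - \<theta>)) sequentially"
    using s by (intro eventually_ball_finite ballI ev) (auto simp: jel_solution_def)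
  ultimately have "eventually (\<lambda>K. (lam1, lam2, \<theta>) \<in> cball 0 (real K) \<and>
      jel_defect K c V1 m1 V2 m2 (lam1, lam2, \<theta>) = 0) sequentially"
    by eventually_elim (use s c in \<open>simp add: jel_defect_eq_0_iff\<close>)
  then show "\<exists>K. \<exists>y\<in>cball 0 (real K). jel_defect K c V1 m1 V2 m2 y = 0"
    using eventually_happens'[OF sequentially_bot] by blast
next
  assume "\<exists>K. \<exists>y\<in>cball 0 (real K). jel_defect K c V1 m1 V2 m2 y = 0"
  then show "\<exists>lam1 lam2 \<theta>. jel_solution V1 m1 V2 m2 lam1 lam2 \<theta> \<and> jel_value V1 m1 V2 m2 lam1 lam2 \<theta> \<le> c"
    by (auto simp: jel_defect_eq_0_iff) blast
qed

lemma sets_jel_llr_greater: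
  assumes meas: "\<And>i. (\<lambda>\<omega>. V1 \<omega> i) \<in> borel_measurable M" "\<And>i. (\<lambda>\<omega>. V2 \<omega> i) \<in> borel_measurable M"
  shows "{\<omega> \<in> space M. jel_llr (V1 \<omega>) m1 (V2 \<omega>) m2 > ereal c} \<in> sets M"
proof -
  let ?A = "\<lambda>K. {\<omega> \<in> space M. \<exists>y\<in>cball 0 (real K). jel_defect K c (V1 \<omega>) m1 (V2 \<omega>) m2 y = 0}"
  have "{\<omega> \<in> space M. jel_llr (V1 \<omega>) m1 (V2 \<omega>) m2 > ereal c} = space M - (\<Union>K. ?A K)"
    unfolding not_le[symmetric] jel_llr_le_iff ex_jel_defect_iff by auto
  moreover have "?A K \<in> sets M" for K
    by (intro sets_exists_zero_compact measurable_jel_defect meas continuous_jel_defect jel_defect_nonneg)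
      simp
  ultimately show ?thesis by auto
qed

text \<open>The hypothesis is restricted to indices in \<open>I\<close> because the sample is known
  to be measurable only from index 1 on.\<close>

lemma measurable_ustat:
  assumes "\<And>k j. k \<in> I \<Longrightarrow> j \<in> I \<Longrightarrow> (\<lambda>\<omega>. h (Z \<omega> k) (Z \<omega> j)) \<in> borel_measurable M"
  shows "(\<lambda>\<omega>. ustat h (Z \<omega>) I) \<in> borel_measurable M"
  unfolding ustat_def
  by (intro borel_measurable_divide borel_measurable_sum borel_measurable_const) (auto intro!: assms)

lemma measurable_jack_pseudo:
  assumes "\<And>k j. k \<in> {1..m} \<Longrightarrow> j \<in> {1..m} \<Longrightarrow> (\<lambda>\<omega>. h (Z \<omega> k) (Z \<omega> j)) \<in> borel_measurable M"
  shows "(\<lambda>\<omega>. jack_pseudo h (Z \<omega>) m i) \<in> borel_measurable M"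
  unfolding jack_pseudo_def
  by (intro borel_measurable_diff borel_measurable_times borel_measurable_const measurable_ustat assms) auto

section \<open>Concentration of U-statistics\<close>

text \<open>Expand the square: for each p only the at most D partners in \<open>N p\<close>
  contribute, and each such product has mean at most s by the inequality of arithmetic and geometric
  means.\<close>

lemma (in prob_space) second_moment_sum_local_dependence:
  fixes Y :: "'i \<Rightarrow> 'a \<Rightarrow> real"
  assumes P: "finite P"
    and meas: "\<And>p. p \<in> P \<Longrightarrow> Y p \<in> borel_measurable M"
    and sq: "\<And>p. p \<in> P \<Longrightarrow> integrable M (\<lambda>\<omega>. (Y p \<omega>)\<^sup>2)"
    and s: "\<And>p. p \<in> P \<Longrightarrow> expectation (\<lambda>\<omega>. (Y p \<omega>)\<^sup>2) \<le> s"
    and N: "\<And>p. p \<in> P \<Longrightarrow> N p \<subseteq> P" "\<And>p. p \<in> P \<Longrightarrow> card (N p) \<le> D"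
    and uncor: "\<And>p q. p \<in> P \<Longrightarrow> q \<in> P - N p \<Longrightarrow> expectation (\<lambda>\<omega>. Y p \<omega> * Y q \<omega>) = 0"
  shows "integrable M (\<lambda>\<omega>. (\<Sum>p\<in>P. Y p \<omega>)\<^sup>2)"
    and "expectation (\<lambda>\<omega>. (\<Sum>p\<in>P. Y p \<omega>)\<^sup>2) \<le> real (card P) * real D * s"
proof -
  have am_gm: "\<bar>x * y\<bar> \<le> (x\<^sup>2 + y\<^sup>2) / 2" for x y :: real
    using sum_squares_bound[of "\<bar>x\<bar>" "\<bar>y\<bar>"] by (simp add: abs_mult)
  have int: "integrable M (\<lambda>\<omega>. Y p \<omega> * Y q \<omega>)" if "p \<in> P" "q \<in> P" for p q
  proof (rule Bochner_Integration.integrable_bound)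
    show "integrable M (\<lambda>\<omega>. ((Y p \<omega>)\<^sup>2 + (Y q \<omega>)\<^sup>2) / 2)" using sq that by simp
    show "(\<lambda>\<omega>. Y p \<omega> * Y q \<omega>) \<in> borel_measurable M" using meas that by measurable
    show "AE \<omega> in M. norm (Y p \<omega> * Y q \<omega>) \<le> norm (((Y p \<omega>)\<^sup>2 + (Y q \<omega>)\<^sup>2) / 2)"
      using am_gm by (intro AE_I2) simp
  qed
  have le: "expectation (\<lambda>\<omega>. Y p \<omega> * Y q \<omega>) \<le> s" if "p \<in> P" "q \<in> P" for p q
  proof -
    have "expectation (\<lambda>\<omega>. Y p \<omega> * Y q \<omega>) \<le> expectation (\<lambda>\<omega>. ((Y p \<omega>)\<^sup>2 + (Y q \<omega>)\<^sup>2) / 2)"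
      using sq that by (intro integral_mono int order.trans[OF abs_ge_self am_gm]) auto
    also have "\<dots> \<le> s" using sq that s[OF that(1)] s[OF that(2)] by simp
    finally show ?thesis .
  qed
  have s0: "0 \<le> s" if "p \<in> P" for p
    by (rule order.trans[OF Bochner_Integration.integral_nonneg s[OF that]]) simp
  have sq_sum: "(\<Sum>p\<in>P. Y p \<omega>)\<^sup>2 = (\<Sum>p\<in>P. \<Sum>q\<in>P. Y p \<omega> * Y q \<omega>)" for \<omega>
    by (simp add: power2_eq_square sum_product)
  show "integrable M (\<lambda>\<omega>. (\<Sum>p\<in>P. Y p \<omega>)\<^sup>2)"
    unfolding sq_sum by (intro Bochner_Integration.integrable_sum int)
  have "expectation (\<lambda>\<omega>. (\<Sum>p\<in>P. Y p \<omega>)\<^sup>2) = (\<Sum>p\<in>P. \<Sum>q\<in>P. expectation (\<lambda>\<omega>. Y p \<omega> * Y q \<omega>))"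
    unfolding sq_sum
    by (simp add: Bochner_Integration.integral_sum Bochner_Integration.integrable_sum int)
  also have "\<dots> \<le> (\<Sum>p\<in>P. real D * s)"
  proof (rule sum_mono)
    fix p assume p: "p \<in> P"
    have "(\<Sum>q\<in>P. expectation (\<lambda>\<omega>. Y p \<omega> * Y q \<omega>)) = (\<Sum>q\<in>N p. expectation (\<lambda>\<omega>. Y p \<omega> * Y q \<omega>))"
      using uncor[OF p] by (intro sum.mono_neutral_right P N p) auto
    also have "\<dots> \<le> real (card (N p)) * s"
      using le[OF p] N(1)[OF p] by (intro sum_bounded_above) auto
    also have "\<dots> \<le> real D * s" using N(2)[OF p] s0[OF p] by (intro mult_right_mono) auto
    finally show "(\<Sum>q\<in>P. expectation (\<lambda>\<omega>. Y p \<omega> * Y q \<omega>)) \<le> real D * s" .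
  qed
  finally show "expectation (\<lambda>\<omega>. (\<Sum>p\<in>P. Y p \<omega>)\<^sup>2) \<le> real (card P) * real D * s" by simp
qed

lemma (in prob_space) indep_vars_indep_var:
  assumes "indep_vars (\<lambda>_. N) X I" "a \<in> I" "b \<in> I" "a \<noteq> b"
  shows "indep_var N (X a) N (X b)"
proof -
  have "indep_var N ((\<lambda>f. f a) \<circ> (\<lambda>\<omega>. restrict (\<lambda>i. X i \<omega>) {a})) N ((\<lambda>f. f b) \<circ> (\<lambda>\<omega>. restrict (\<lambda>i. X i \<omega>) {b}))"
    using assms
    by (intro indep_var_compose[OF indep_var_restrict[OF assms(1), of "{a}" "{b}"]]) auto
  then show ?thesis by (simp add: comp_def)
qed

lemma (in prob_space) distr_pair_iid:
  assumes "indep_vars (\<lambda>_. N) X I" and ident: "\<And>i. i \<in> I \<Longrightarrow> distr M N (X i) = F"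
    and "a \<in> I" "b \<in> I" "a \<noteq> b"
  shows "distr M (N \<Otimes>\<^sub>M N) (\<lambda>\<omega>. (X a \<omega>, X b \<omega>)) = F \<Otimes>\<^sub>M F"
  using indep_vars_indep_var[OF assms(1,3,4,5)] ident[OF assms(3)] ident[OF assms(4)]
  by (simp add: indep_var_distribution_eq)

text \<open>Chebyshev's inequality. Kernel values on disjoint pairs are independent, so the second
  moment of the sum over pairs has order m^3, against m^4 for the squared number of pairs. The shift
  \<open>s\<close> serves the second half of the sample.\<close>

lemma (in prob_space) ustat_concentration:
  fixes X :: "nat \<Rightarrow> 'a \<Rightarrow> 'b" and h :: "'b \<Rightarrow> 'b \<Rightarrow> real"
  assumes indep: "indep_vars (\<lambda>_. N) X {1..}"
    and ident: "\<And>i. 1 \<le> i \<Longrightarrow> distr M N (X i) = F"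
    and h[measurable]: "(\<lambda>p. h (fst p) (snd p)) \<in> borel_measurable (N \<Otimes>\<^sub>M N)"
    and h2: "integrable (F \<Otimes>\<^sub>M F) (\<lambda>p. (h (fst p) (snd p))\<^sup>2)"
    and m: "2 \<le> m" and \<epsilon>: "0 < \<epsilon>"
  defines "\<theta> \<equiv> \<integral>p. h (fst p) (snd p) \<partial>(F \<Otimes>\<^sub>M F)"
  defines "\<sigma>2 \<equiv> \<integral>p. (h (fst p) (snd p) - \<theta>)\<^sup>2 \<partial>(F \<Otimes>\<^sub>M F)"
  shows "prob {\<omega> \<in> space M. \<epsilon> \<le> \<bar>ustat h (\<lambda>i. X (s + i) \<omega>) {1..m} - \<theta>\<bar>} \<le> 8 * \<sigma>2 / ((real m - 1) * \<epsilon>\<^sup>2)"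
proof -
  let ?P = "less_pairs {1..m}"
  define Y where "Y = (\<lambda>(k, j) \<omega>. h (X (s + k) \<omega>) (X (s + j) \<omega>) - \<theta>)"
  define Nb where "Nb = (\<lambda>(k, j). {(a, b) \<in> ?P. a \<in> {k, j} \<or> b \<in> {k, j}})"
  have r: "real m \<ge> 2" using m by simp
  have [measurable]: "X i \<in> M \<rightarrow>\<^sub>M N" if "1 \<le> i" for i
    using indep that by (auto simp: indep_vars_def)
  have pair_meas: "(\<lambda>\<omega>. (X a \<omega>, X b \<omega>)) \<in> M \<rightarrow>\<^sub>M N \<Otimes>\<^sub>M N" if "1 \<le> a" "1 \<le> b" for a b
    using that by measurable
  have pair: "distr M (N \<Otimes>\<^sub>M N) (\<lambda>\<omega>. (X a \<omega>, X b \<omega>)) = F \<Otimes>\<^sub>M F" if "1 \<le> a" "1 \<le> b" "a \<noteq> b" for a b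
    using that by (intro distr_pair_iid[OF indep]) (auto intro: ident)
  have F: "prob_space F" "sets F = sets N"
    using prob_space_distr[of "X 1" N] ident[of 1, symmetric] by auto
  interpret F: prob_space F by fact
  interpret FF: pair_prob_space F F ..
  have meas_FF: "(\<lambda>p. h (fst p) (snd p)) \<in> borel_measurable (F \<Otimes>\<^sub>M F)"
    using h by (simp cong: measurable_cong_sets add: F(2) sets_pair_measure_cong[OF F(2) F(2)])
  have h1: "integrable (F \<Otimes>\<^sub>M F) (\<lambda>p. h (fst p) (snd p))"
    using FF.square_integrable_imp_integrable[OF meas_FF h2] .
  have hc: "integrable (F \<Otimes>\<^sub>M F) (\<lambda>p. h (fst p) (snd p) - \<theta>)"
    "integrable (F \<Otimes>\<^sub>M F) (\<lambda>p. (h (fst p) (snd p) - \<theta>)\<^sup>2)"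
    using h1 h2 by (simp_all add: power2_diff)
  have transfer: "integrable M (\<lambda>\<omega>. g (X a \<omega>, X b \<omega>))" "expectation (\<lambda>\<omega>. g (X a \<omega>, X b \<omega>)) = (\<integral>p. g p \<partial>(F \<Otimes>\<^sub>M F))"
    if "1 \<le> a" "1 \<le> b" "a \<noteq> b" "g \<in> borel_measurable (N \<Otimes>\<^sub>M N)" "integrable (F \<Otimes>\<^sub>M F) g"
    for a b and g :: "'b \<times> 'b \<Rightarrow> real"
    using integrable_distr_eq[OF pair_meas that(4), of a b] integral_distr[OF pair_meas that(4), of a b]
      pair[OF that(1-3)] that by simp_all
  have Ypair: "Y (k, j) = (\<lambda>\<omega>. (\<lambda>p. h (fst p) (snd p) - \<theta>) (X (s + k) \<omega>, X (s + j) \<omega>))" for k j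
    by (simp add: Y_def)
  have hm: "(\<lambda>p. h (fst p) (snd p) - \<theta>) \<in> borel_measurable (N \<Otimes>\<^sub>M N)"
    "(\<lambda>p. (h (fst p) (snd p) - \<theta>)\<^sup>2) \<in> borel_measurable (N \<Otimes>\<^sub>M N)"
    by measurable
  have YM: "Y p \<in> borel_measurable M" if "p \<in> ?P" for p
    using that measurable_compose[OF pair_meas hm(1)] by (cases p) (auto simp: Ypair)
  have Y1: "integrable M (Y p)" "expectation (Y p) = 0" if "p \<in> ?P" for p
    using that transfer[OF _ _ _ hm(1) hc(1)] h1 by (cases p; simp add: Ypair \<theta>_def FF.prob_space)+
  have Y2: "integrable M (\<lambda>\<omega>. (Y p \<omega>)\<^sup>2)" "expectation (\<lambda>\<omega>. (Y p \<omega>)\<^sup>2) = \<sigma>2" if "p \<in> ?P" for p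
    using that transfer[OF _ _ _ hm(2) hc(2)] by (cases p; simp add: Ypair \<sigma>2_def)+
  have uncor: "expectation (\<lambda>\<omega>. Y p \<omega> * Y q \<omega>) = 0" if p: "p \<in> ?P" and q: "q \<in> ?P - Nb p" for p q
  proof -
    obtain k j a b where [simp]: "p = (k, j)" "q = (a, b)" by (cases p, cases q)
    let ?r = "\<lambda>A \<omega>. restrict (\<lambda>i. X i \<omega>) A"
    let ?g = "\<lambda>k j f. h (f (s + k)) (f (s + j)) - \<theta>"
    have g: "?g k j \<in> borel_measurable (PiM {s + k, s + j} (\<lambda>_. N))" for k j
    proof -
      have "(\<lambda>f. (f (s + k), f (s + j))) \<in> PiM {s + k, s + j} (\<lambda>_. N) \<rightarrow>\<^sub>M N \<Otimes>\<^sub>M N" by measurable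
      from measurable_compose[OF this hm(1)] show ?thesis by simp
    qed
    have "indep_var borel (?g k j \<circ> ?r {s + k, s + j}) borel (?g a b \<circ> ?r {s + a, s + b})"
      by (intro indep_var_compose[OF indep_var_restrict[OF indep]] g) (use p q in \<open>auto simp: Nb_def\<close>)
    then have "indep_var borel (Y p) borel (Y q)"
      by (simp add: comp_def Y_def)
    then show ?thesis
      using Y1[OF p] Y1[of q] q by (subst indep_var_lebesgue_integral) auto
  qed
  \<comment> \<open>A pair meets {k, j} in its first or its second entry, with at most 2 * m pairs
    each.\<close>
  have Nb_card: "card (Nb p) \<le> 4 * m" if "p \<in> ?P" for p
  proof -
    obtain k j where [simp]: "p = (k, j)" by (cases p)
    have "Nb p \<subseteq> {k, j} \<times> {1..m} \<union> {1..m} \<times> {k, j}" by (auto simp: Nb_def)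
    then have "card (Nb p) \<le> card ({k, j} \<times> {1..m} \<union> {1..m} \<times> {k, j})"
      by (intro card_mono) auto
    also have "\<dots> \<le> card ({k, j} \<times> {1..m}) + card ({1..m} \<times> {k, j})" by (rule card_Un_le)
    also have "\<dots> \<le> 4 * m" by (simp add: card_cartesian_product card_insert_if)
    finally show ?thesis .
  qed
  have finP: "finite ?P" by (rule finite_less_pairs) simp
  define c where "c = real (m choose 2)"
  have c: "c = real m * (real m - 1) / 2" unfolding c_def by (rule real_choose_2)
  have c0: "c > 0" unfolding c using r by (intro divide_pos_pos mult_pos_pos) auto
  have cardP: "real (card ?P) = c" unfolding c_def by (subst card_less_pairs) simp_all
  let ?S = "\<lambda>\<omega>. \<Sum>p\<in>?P. Y p \<omega>"
  note second = second_moment_sum_local_dependence[OF finP YM Y2(1) eq_refl[OF Y2(2)] _ Nb_card uncor]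
  have S2: "integrable M (\<lambda>\<omega>. (?S \<omega>)\<^sup>2)" "expectation (\<lambda>\<omega>. (?S \<omega>)\<^sup>2) \<le> real (card ?P) * real (4 * m) * \<sigma>2"
    by (rule second; auto simp: Nb_def)+
  have U: "ustat h (\<lambda>i. X (s + i) \<omega>) {1..m} - \<theta> = ?S \<omega> / c" for \<omega>
  proof -
    have "?S \<omega> = (\<Sum>(k, j)\<in>?P. h (X (s + k) \<omega>) (X (s + j) \<omega>)) - c * \<theta>"
      by (simp add: Y_def case_prod_unfold sum_subtractf cardP[symmetric, unfolded case_prod_unfold])
    moreover have "ustat h (\<lambda>i. X (s + i) \<omega>) {1..m} = (\<Sum>(k, j)\<in>?P. h (X (s + k) \<omega>) (X (s + j) \<omega>)) / c"
      by (simp add: ustat_def c_def)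
    ultimately show ?thesis using c0 by (simp add: diff_divide_distrib)
  qed
  have [measurable]: "?S \<in> borel_measurable M" by (intro borel_measurable_sum YM)
  have "{\<omega> \<in> space M. \<epsilon> \<le> \<bar>ustat h (\<lambda>i. X (s + i) \<omega>) {1..m} - \<theta>\<bar>} = {\<omega> \<in> space M. (\<epsilon> * c)\<^sup>2 \<le> (?S \<omega>)\<^sup>2}"
  proof -
    have "\<epsilon> \<le> \<bar>x / c\<bar> \<longleftrightarrow> (\<epsilon> * c)\<^sup>2 \<le> x\<^sup>2" for x
    proof -
      have "\<epsilon> \<le> \<bar>x / c\<bar> \<longleftrightarrow> \<bar>\<epsilon> * c\<bar> \<le> \<bar>x\<bar>" using c0 \<epsilon> by (simp add: abs_mult le_divide_eq)
      then show ?thesis by (simp only: abs_le_square_iff)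
    qed
    then show ?thesis unfolding U by simp
  qed
  also have "prob \<dots> \<le> expectation (\<lambda>\<omega>. (?S \<omega>)\<^sup>2) / (\<epsilon> * c)\<^sup>2"
    using c0 \<epsilon> by (intro integral_Markov_inequality_measure[OF S2(1)] AE_I2) (auto intro: sets.sets_Collect simp: zero_less_mult_iff)
  also have "\<dots> \<le> (c * real (4 * m) * \<sigma>2) / (\<epsilon> * c)\<^sup>2"
    using S2(2) unfolding cardP by (intro divide_right_mono) auto
  also have "\<dots> = 8 * \<sigma>2 / ((real m - 1) * \<epsilon>\<^sup>2)"
    using c0 \<epsilon> r unfolding c by (simp add: divide_simps power2_eq_square)
  finally show ?thesis .
qed

section \<open>Consistency\<close>

lemma h1_bounds: "0 \<le> h1 x y" "h1 x y \<le> norm x + norm y"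
  by (simp_all add: h1_def norm_triangle_ineq)

lemma h2_bounds: "0 \<le> h2 x y" "h2 x y \<le> norm x + norm y"
  by (simp_all add: h2_def norm_triangle_ineq4)

lemma jel_stat_ge:
  fixes x :: "nat \<Rightarrow> 'a::real_normed_vector"
  assumes m: "3 \<le> m1" "3 \<le> m2" and k: "0 < k" "k \<le> real m1" "k \<le> real m2" and \<delta>: "0 \<le> \<delta>"
    and small: "2088 * (\<delta> / k)\<^sup>2 * ((\<Sum>i=1..m1. (norm (x i))\<^sup>2) + (\<Sum>j=1..m2. (norm (x (m1 + j)))\<^sup>2)) \<le> 1 / 4"
  shows "ereal (2 * \<delta> * (ustat h1 x {1..m1} - ustat h2 (\<lambda>i. x (m1 + i)) {1..m2}) - 1) \<le> jel_stat m1 m2 x"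
  unfolding jel_stat_def
proof (rule jel_llr_ge_gap[OF k \<delta> _ sum_jack_pseudo sum_jack_pseudo])
  let ?S1 = "\<Sum>i=1..m1. (jack_pseudo h1 x m1 i)\<^sup>2"
    and ?S2 = "\<Sum>j=1..m2. (jack_pseudo h2 (\<lambda>i. x (m1 + i)) m2 j)\<^sup>2"
  have "?S1 + ?S2 \<le> 2088 * (\<Sum>i=1..m1. (norm (x i))\<^sup>2) + 2088 * (\<Sum>j=1..m2. (norm (x (m1 + j)))\<^sup>2)"
    by (intro add_mono sum_square_jack_pseudo_le m h1_bounds h2_bounds)
  then have "(\<delta> / k)\<^sup>2 * (?S1 + ?S2) \<le> (\<delta> / k)\<^sup>2 *
      (2088 * (\<Sum>i=1..m1. (norm (x i))\<^sup>2) + 2088 * (\<Sum>j=1..m2. (norm (x (m1 + j)))\<^sup>2))"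
    by (intro mult_left_mono) auto
  also have "\<dots> = 2088 * (\<delta> / k)\<^sup>2 * ((\<Sum>i=1..m1. (norm (x i))\<^sup>2) + (\<Sum>j=1..m2. (norm (x (m1 + j)))\<^sup>2))"
    by (simp only: distrib_left mult_ac)
  also note small
  finally show "(\<delta> / k)\<^sup>2 * (?S1 + ?S2) \<le> 1 / 4" .
qed (use m in auto)

lemma sets_jel_stat_greater:
  fixes X :: "nat \<Rightarrow> 'w \<Rightarrow> 'a::euclidean_space"
  assumes X: "\<And>i. 1 \<le> i \<Longrightarrow> X i \<in> borel_measurable M"
  shows "{\<omega> \<in> space M. jel_stat m1 m2 (\<lambda>i. X i \<omega>) > ereal c} \<in> sets M"
  unfolding jel_stat_def h1_def h2_def
  by (intro sets_jel_llr_greater measurable_jack_pseudo borel_measurable_norm[THEN measurable_compose[rotated]]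
      borel_measurable_add borel_measurable_diff X) auto

text \<open>Fubini provides one point x at which y \<mapsto> norm (x - y) is integrable; the
  triangle inequality does the rest.\<close>

lemma integrable_norm_of_integrable_diff:
  fixes F :: "'a::euclidean_space measure"
  assumes "prob_space F" and [measurable_cong]: "sets F = sets borel"
    and diff: "integrable (F \<Otimes>\<^sub>M F) (\<lambda>p. norm (fst p - snd p))"
  shows "integrable F norm"
proof -
  interpret prob_space F by fact
  interpret FF: pair_prob_space F F ..
  from FF.AE_integrable_fst'[OF diff]
  have "AE x in F. integrable F (\<lambda>y. norm (x - y))" by simp
  then obtain x where x: "integrable F (\<lambda>y. norm (x - y))"
    using eventually_happens'[of "ae_filter F"] ae_filter_bot by blast
  show ?thesis
  proof (rule Bochner_Integration.integrable_bound)
    show "integrable F (\<lambda>y. norm (x - y) + norm x)" using x by simp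
    have "norm y \<le> norm (x - y) + norm x" for y
      using norm_triangle_ineq4[of x "x - y"] by simp
    then show "AE y in F. norm (norm y) \<le> norm (norm (x - y) + norm x)" by (intro AE_I2) simp
  qed measurable
qed

text \<open>The norm of x exceeds g2 x by at most a constant, so a finite variance of g2 at X1
  bounds the second moment of X1. Integrability of the norm of X2 ensures that the expectation
  inside \<open>g2\<close> is a genuine one and not the default 0.\<close>

lemma (in prob_space) integrable_norm_square_of_variance:
  fixes X :: "nat \<Rightarrow> 'a \<Rightarrow> 'b::euclidean_space"
  assumes [measurable]: "X 1 \<in> borel_measurable M" and X2: "X 2 \<in> borel_measurable M"
    and int: "integrable M (\<lambda>\<omega>. norm (X 2 \<omega>))"
    and var: "pos_finite_variance M (\<lambda>\<omega>. g2 M X (X 1 \<omega>))"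
  shows "integrable M (\<lambda>\<omega>. (norm (X 1 \<omega>))\<^sup>2)"
proof -
  define e where "e = expectation (\<lambda>\<omega>. g2 M X (X 1 \<omega>))"
  define C where "C = expectation (\<lambda>\<omega>. norm (X 2 \<omega>)) + theta0 M X + e"
  have bound: "norm (X 1 \<omega>) \<le> (g2 M X (X 1 \<omega>) - e) + C" for \<omega>
  proof -
    let ?x = "X 1 \<omega>"
    have i: "integrable M (\<lambda>\<eta>. norm (?x - X 2 \<eta>))"
    proof (rule Bochner_Integration.integrable_bound)
      show "integrable M (\<lambda>\<eta>. norm ?x + norm (X 2 \<eta>))" using int by simp
      show "AE \<eta> in M. norm (norm (?x - X 2 \<eta>)) \<le> norm (norm ?x + norm (X 2 \<eta>))"
        by (intro AE_I2) (simp add: norm_triangle_ineq4)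
    qed (use X2 in measurable)
    have "expectation (\<lambda>\<eta>. norm ?x - norm (X 2 \<eta>)) \<le> expectation (\<lambda>\<eta>. norm (?x - X 2 \<eta>))"
      using int i by (intro integral_mono) (auto simp: norm_triangle_ineq2)
    then have "norm ?x - expectation (\<lambda>\<eta>. norm (X 2 \<eta>)) \<le> expectation (\<lambda>\<eta>. norm (?x - X 2 \<eta>))"
      using int by (simp add: prob_space)
    then show ?thesis by (simp add: C_def g2_def)
  qed
  have "integrable M (\<lambda>\<omega>. (g2 M X (X 1 \<omega>) - e)\<^sup>2)"
    using var by (simp add: pos_finite_variance_def e_def)
  then have "integrable M (\<lambda>\<omega>. 2 * (g2 M X (X 1 \<omega>) - e)\<^sup>2 + 2 * C\<^sup>2)" by simp
  then show ?thesis
  proof (rule Bochner_Integration.integrable_bound)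
    have "(norm (X 1 \<omega>))\<^sup>2 \<le> 2 * (g2 M X (X 1 \<omega>) - e)\<^sup>2 + 2 * C\<^sup>2" for \<omega>
      using power_mono[OF bound, of \<omega> 2] square_sum_le[of "g2 M X (X 1 \<omega>) - e" C] by simp
    then show "AE \<omega> in M. norm ((norm (X 1 \<omega>))\<^sup>2) \<le> norm (2 * (g2 M X (X 1 \<omega>) - e)\<^sup>2 + 2 * C\<^sup>2)"
      by (intro AE_I2) simp
  qed measurable
qed

theorem theorem2p2:
  fixes M :: "'w measure"
    and F :: "(real ^ 'd) measure"
    and X :: "nat \<Rightarrow> 'w \<Rightarrow> real ^ 'd"
    and n1 n2 :: "nat \<Rightarrow> nat"
    and \<alpha>1 \<alpha>2 \<alpha> :: real
  assumes M: "prob_space M"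
    and indep: "prob_space.indep_vars M (\<lambda>_. borel) X {1..}"
    and ident: "\<And>i. 1 \<le> i \<Longrightarrow> distr M borel (X i) = F"
    and theta0_finite: "integrable M (\<lambda>\<omega>. norm (X 1 \<omega> - X 2 \<omega>))"
    and C1: "pos_finite_variance M (\<lambda>\<omega>. g1 M X (X 1 \<omega>))"
            "pos_finite_variance M (\<lambda>\<omega>. g2 M X (X 1 \<omega>))"
    and C2: "\<And>n. n = n1 n + n2 n"
            "(\<lambda>n. real (n1 n) / real n) \<longlonglongrightarrow> \<alpha>1" "0 < \<alpha>1"
            "(\<lambda>n. real (n2 n) / real n) \<longlonglongrightarrow> \<alpha>2" "0 < \<alpha>2"
            "\<alpha>1 + \<alpha>2 = 1"
    and level: "0 < \<alpha>" "\<alpha> < 1"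
    and alternative: "distr M borel (X 1) \<noteq> distr M borel (\<lambda>\<omega>. - X 1 \<omega>)"
  shows "(\<lambda>n. prob_space.prob M {\<omega> \<in> space M.
            jel_stat (n1 n) (n2 n) (\<lambda>i. X i \<omega>) > ereal (quantile chi_square_1 (1 - \<alpha>))})
         \<longlonglongrightarrow> 1"
proof -
  interpret prob_space M by (rule M)
  have X[measurable]: "X i \<in> borel_measurable M" if "1 \<le> i" for i
    using indep that by (auto simp: indep_vars_def)
  have F: "prob_space F" "sets F = sets borel"
    using prob_space_distr[OF X[of 1]] ident[of 1, symmetric] by auto
  note [measurable_cong] = F(2)
  interpret F: prob_space F by (rule F)
  interpret FF: pair_prob_space F F ..
  have FFdistr: "F \<Otimes>\<^sub>M F = distr M (borel \<Otimes>\<^sub>M borel) (\<lambda>\<omega>. (X 1 \<omega>, X 2 \<omega>))"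
    by (rule distr_pair_iid[OF indep, symmetric]) (auto intro: ident)
  have "integrable (F \<Otimes>\<^sub>M F) (\<lambda>p. norm (fst p - snd p))"
    unfolding FFdistr using theta0_finite by (subst integrable_distr_eq) auto
  then have normF: "integrable F norm"
    by (rule integrable_norm_of_integrable_diff[OF F])
  have X_F: "integrable M (\<lambda>\<omega>. f (X i \<omega>)) \<longleftrightarrow> integrable F f" "expectation (\<lambda>\<omega>. f (X i \<omega>)) = (\<integral>x. f x \<partial>F)"
    if "1 \<le> i" "f \<in> borel_measurable borel" for i and f :: "real ^ 'd \<Rightarrow> real"
    unfolding ident[OF that(1), symmetric] using that by (simp_all add: integrable_distr_eq integral_distr)
  have "integrable M (\<lambda>\<omega>. norm (X 2 \<omega>))"
    using normF by (subst X_F) auto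
  then have "integrable M (\<lambda>\<omega>. (norm (X 1 \<omega>))\<^sup>2)"
    by (intro integrable_norm_square_of_variance C1(2) X) auto
  then have sqF: "integrable F (\<lambda>x. (norm x)\<^sup>2)"
    by (subst (asm) X_F) auto
  define B where "B = (\<integral>x. (norm x)\<^sup>2 \<partial>F)"
  have sqX: "integrable M (\<lambda>\<omega>. (norm (X i \<omega>))\<^sup>2)" "expectation (\<lambda>\<omega>. (norm (X i \<omega>))\<^sup>2) = B" if "1 \<le> i" for i
    using sqF X_F[OF that, of "\<lambda>x. (norm x)\<^sup>2"] by (simp_all add: B_def)
  have "integrable (F \<Otimes>\<^sub>M F) (\<lambda>p. (norm (fst p))\<^sup>2)" "integrable (F \<Otimes>\<^sub>M F) (\<lambda>p. (norm (snd p))\<^sup>2)"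
    by (rule FF.Fubini_integrable; use sqF in simp)+
  then have sqFF: "integrable (F \<Otimes>\<^sub>M F) (\<lambda>p. 2 * (norm (fst p))\<^sup>2 + 2 * (norm (snd p))\<^sup>2)" by simp
  have h_sq: "integrable (F \<Otimes>\<^sub>M F) (\<lambda>p. (h (fst p) (snd p))\<^sup>2)"
    if [measurable]: "(\<lambda>p. h (fst p) (snd p)) \<in> borel_measurable (borel \<Otimes>\<^sub>M borel)"
      and b: "\<And>x y. 0 \<le> h x y" "\<And>x y. h x y \<le> norm x + norm y" for h :: "real ^ 'd \<Rightarrow> real ^ 'd \<Rightarrow> real"
  proof (rule Bochner_Integration.integrable_bound[OF sqFF])
    have "(h x y)\<^sup>2 \<le> 2 * (norm x)\<^sup>2 + 2 * (norm y)\<^sup>2" for x y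
      using power_mono[OF b(2) b(1), of x y 2] square_sum_le[of "norm x" "norm y"] by simp
    then show "AE p in F \<Otimes>\<^sub>M F. norm ((h (fst p) (snd p))\<^sup>2) \<le> norm (2 * (norm (fst p))\<^sup>2 + 2 * (norm (snd p))\<^sup>2)"
      by (intro AE_I2) simp
  qed measurable
  have hm: "(\<lambda>p. h1 (fst p) (snd p :: real ^ 'd)) \<in> borel_measurable (borel \<Otimes>\<^sub>M borel)"
    "(\<lambda>p. h2 (fst p) (snd p :: real ^ 'd)) \<in> borel_measurable (borel \<Otimes>\<^sub>M borel)"
    unfolding h1_def h2_def by measurable
  define \<theta>1 where "\<theta>1 = (\<integral>p. h1 (fst p) (snd p) \<partial>(F \<Otimes>\<^sub>M F))"
  define \<theta>2 where "\<theta>2 = (\<integral>p. h2 (fst p) (snd p) \<partial>(F \<Otimes>\<^sub>M F))"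
  define s1 where "s1 = (\<integral>p. (h1 (fst p) (snd p) - \<theta>1)\<^sup>2 \<partial>(F \<Otimes>\<^sub>M F))"
  define s2 where "s2 = (\<integral>p. (h2 (fst p) (snd p) - \<theta>2)\<^sup>2 \<partial>(F \<Otimes>\<^sub>M F))"
  have s0: "0 \<le> s1" "0 \<le> s2" unfolding s1_def s2_def by (intro Bochner_Integration.integral_nonneg; simp)+
  define \<Delta> where "\<Delta> = \<theta>1 - \<theta>2"
  have "distr M borel (\<lambda>\<omega>. - X 1 \<omega>) = distr F borel uminus"
    unfolding ident[of 1, simplified, symmetric] by (subst distr_distr) (auto simp: comp_def)
  with alternative have "F \<noteq> distr F borel uminus" by (simp add: ident)
  from norm_sum_gt_norm_diff[OF F normF this]
  have \<Delta>: "0 < \<Delta>" by (simp add: \<Delta>_def \<theta>1_def \<theta>2_def h1_def h2_def)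
  \<comment> \<open>Two deviations below \<Delta> / 4 leave a gap of at least \<Delta> / 2 between
    the U-statistics.\<close>
  define \<epsilon> where "\<epsilon> = \<Delta> / 4"
  have \<epsilon>: "0 < \<epsilon>" using \<Delta> by (simp add: \<epsilon>_def)
  define c where "c = quantile chi_square_1 (1 - \<alpha>)"
  \<comment> \<open>With a gap of \<Delta> / 2 the dual bound becomes |c| + 2 - 1, which exceeds
    c.\<close>
  define \<delta> where "\<delta> = (\<bar>c\<bar> + 2) / \<Delta>"
  have \<delta>: "0 < \<delta>" using \<Delta> by (simp add: \<delta>_def)
  \<comment> \<open>Half the smaller limiting proportion: eventually both sample sizes are at least
    \<kappa> * n.\<close>
  define \<kappa> where "\<kappa> = min \<alpha>1 \<alpha>2 / 2"
  have \<kappa>: "0 < \<kappa>" "\<kappa> < \<alpha>1" "\<kappa> < \<alpha>2" using C2 by (auto simp: \<kappa>_def min_def)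
  \<comment> \<open>As 8352 = 4 * 2088, this threshold turns the smallness condition of
    \<open>jel_stat_ge\<close> into exactly 1/4 when k is \<kappa> * n.\<close>
  define \<tau> where "\<tau> = \<kappa>\<^sup>2 / (8352 * \<delta>\<^sup>2)"
  have \<tau>: "0 < \<tau>" using \<kappa> \<delta> by (simp add: \<tau>_def)
  define A where "A n = {\<omega> \<in> space M. jel_stat (n1 n) (n2 n) (\<lambda>i. X i \<omega>) > ereal c}" for n
  have A[measurable]: "A n \<in> events" for n
    unfolding A_def by (intro sets_jel_stat_greater X)
  define bad where "bad n = 8 * s1 / ((\<kappa> * real n - 1) * \<epsilon>\<^sup>2) + 8 * s2 / ((\<kappa> * real n - 1) * \<epsilon>\<^sup>2) + B / (\<tau> * real n)" for n
  have bad0: "bad \<longlonglongrightarrow> 0"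
  proof -
    have lin: "filterlim (\<lambda>n. b * real n) at_top sequentially" if "0 < b" for b
      by (rule filterlim_tendsto_pos_mult_at_top[OF tendsto_const that filterlim_real_sequentially])
    have "filterlim (\<lambda>n. \<epsilon>\<^sup>2 * (- 1 + \<kappa> * real n)) at_top sequentially"
      using \<epsilon> \<kappa> by (intro filterlim_tendsto_pos_mult_at_top[OF tendsto_const]
        filterlim_tendsto_add_at_top[OF tendsto_const] lin) auto
    then have 1: "(\<lambda>n. a / ((\<kappa> * real n - 1) * \<epsilon>\<^sup>2)) \<longlonglongrightarrow> 0" for a
      using real_tendsto_divide_at_top[OF tendsto_const[of a]] by (simp add: mult.commute)
    have 2: "(\<lambda>n. B / (\<tau> * real n)) \<longlonglongrightarrow> 0"
      by (rule real_tendsto_divide_at_top[OF tendsto_const lin[OF \<tau>]])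
    show ?thesis unfolding bad_def using tendsto_add[OF tendsto_add[OF 1 1] 2] by simp
  qed
  have "eventually (\<lambda>n. 1 - bad n \<le> prob (A n)) sequentially"
  proof -
    have "eventually (\<lambda>n. \<kappa> < real (n1 n) / real n) sequentially"
      "eventually (\<lambda>n. \<kappa> < real (n2 n) / real n) sequentially"
      using C2(2,4) \<kappa> by (auto intro: order_tendstoD(1))
    then show ?thesis using eventually_ge_at_top[of "nat \<lceil>3 / \<kappa>\<rceil>"] eventually_gt_at_top[of 0]
    proof eventually_elim
      case (elim n)
      then have n: "real n > 0" by simp
      have k: "\<kappa> * real n \<le> real (n1 n)" "\<kappa> * real n \<le> real (n2 n)"
        using elim n by (auto simp: less_divide_eq)
      have "3 / \<kappa> \<le> real n" using elim(3) by linarith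
      then have k3: "3 \<le> \<kappa> * real n" using \<kappa> by (simp add: divide_le_eq mult.commute)
      then have m: "3 \<le> n1 n" "3 \<le> n2 n" using k by linarith+
      let ?U1 = "\<lambda>\<omega>. ustat h1 (\<lambda>i. X (0 + i) \<omega>) {1..n1 n}"
      let ?U2 = "\<lambda>\<omega>. ustat h2 (\<lambda>i. X (n1 n + i) \<omega>) {1..n2 n}"
      let ?T = "\<lambda>\<omega>. (\<Sum>i=1..n1 n. (norm (X i \<omega>))\<^sup>2) + (\<Sum>j=1..n2 n. (norm (X (n1 n + j) \<omega>))\<^sup>2)"
      let ?B1 = "{\<omega> \<in> space M. \<epsilon> \<le> \<bar>?U1 \<omega> - \<theta>1\<bar>}" and ?B2 = "{\<omega> \<in> space M. \<epsilon> \<le> \<bar>?U2 \<omega> - \<theta>2\<bar>}"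
      let ?B3 = "{\<omega> \<in> space M. \<tau> * (real n)\<^sup>2 \<le> ?T \<omega>}"
      have [measurable]: "?U1 \<in> borel_measurable M" "?U2 \<in> borel_measurable M"
        unfolding h1_def h2_def
        by (intro measurable_ustat borel_measurable_norm[THEN measurable_compose[rotated]]
            borel_measurable_add borel_measurable_diff X; simp)+
      have Tint: "integrable M ?T"
        by (intro Bochner_Integration.integrable_add Bochner_Integration.integrable_sum sqX) auto
      then have [measurable]: "?T \<in> borel_measurable M" by simp
      have ET: "expectation ?T = real n * B"
      proof -
        have "expectation ?T = (\<Sum>i=1..n1 n. B) + (\<Sum>j=1..n2 n. B)"
          by (subst Bochner_Integration.integral_add)
            (auto simp: Bochner_Integration.integral_sum sqX intro!: Bochner_Integration.integrable_sum)
        also have "\<dots> = real (n1 n + n2 n) * B" by (simp add: distrib_right)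
        finally show ?thesis by (simp only: C2(1)[symmetric])
      qed
      have e: "?B1 \<in> events" "?B2 \<in> events" "?B3 \<in> events" by measurable
      have p1: "prob ?B1 \<le> 8 * s1 / ((\<kappa> * real n - 1) * \<epsilon>\<^sup>2)"
      proof -
        have "prob ?B1 \<le> 8 * s1 / ((real (n1 n) - 1) * \<epsilon>\<^sup>2)"
          unfolding s1_def \<theta>1_def
          by (rule ustat_concentration[OF indep ident hm(1) h_sq[OF hm(1) h1_bounds] _ \<epsilon>]) (use m in auto)
        also have "\<dots> \<le> 8 * s1 / ((\<kappa> * real n - 1) * \<epsilon>\<^sup>2)"
          using s0 k k3 \<epsilon> by (intro divide_left_mono mult_right_mono mult_pos_pos) auto
        finally show ?thesis .
      qed
      have p2: "prob ?B2 \<le> 8 * s2 / ((\<kappa> * real n - 1) * \<epsilon>\<^sup>2)"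
      proof -
        have "prob ?B2 \<le> 8 * s2 / ((real (n2 n) - 1) * \<epsilon>\<^sup>2)"
          unfolding s2_def \<theta>2_def
          by (rule ustat_concentration[OF indep ident hm(2) h_sq[OF hm(2) h2_bounds] _ \<epsilon>]) (use m in auto)
        also have "\<dots> \<le> 8 * s2 / ((\<kappa> * real n - 1) * \<epsilon>\<^sup>2)"
          using s0 k k3 \<epsilon> by (intro divide_left_mono mult_right_mono mult_pos_pos) auto
        finally show ?thesis .
      qed
      \<comment> \<open>The mean of \<open>?T\<close> is linear in n and the threshold is quadratic,
        so Markov's inequality already gives a bound of order 1/n.\<close>
      have p3: "prob ?B3 \<le> B / (\<tau> * real n)"
      proof -
        have "prob ?B3 \<le> expectation ?T / (\<tau> * (real n)\<^sup>2)"
          using \<tau> n by (intro integral_Markov_inequality_measure[OF Tint e(3)] AE_I2)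
            (auto intro!: add_nonneg_nonneg sum_nonneg)
        also have "\<dots> = B / (\<tau> * real n)" unfolding ET using n \<tau> by (simp add: power2_eq_square)
        finally show ?thesis .
      qed
      have sub: "space M - A n \<subseteq> ?B1 \<union> ?B2 \<union> ?B3"
      proof (rule ccontr)
        assume "\<not> ?thesis"
        then obtain \<omega> where \<omega>: "\<omega> \<in> space M" "\<omega> \<notin> A n" "\<omega> \<notin> ?B1" "\<omega> \<notin> ?B2" "\<omega> \<notin> ?B3" by blast
        then have u: "\<bar>?U1 \<omega> - \<theta>1\<bar> < \<epsilon>" "\<bar>?U2 \<omega> - \<theta>2\<bar> < \<epsilon>" and T: "?T \<omega> < \<tau> * (real n)\<^sup>2" by auto
        have "2088 * (\<delta> / (\<kappa> * real n))\<^sup>2 * ?T \<omega> \<le> 2088 * (\<delta> / (\<kappa> * real n))\<^sup>2 * (\<tau> * (real n)\<^sup>2)"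
          using T by (intro mult_left_mono) auto
        also have "\<dots> = 1 / 4"
          using \<delta> \<kappa> n by (simp add: \<tau>_def field_simps power2_eq_square)
        finally have small: "2088 * (\<delta> / (\<kappa> * real n))\<^sup>2 * ?T \<omega> \<le> 1 / 4" .
        have "ereal (2 * \<delta> * (?U1 \<omega> - ?U2 \<omega>) - 1) \<le> jel_stat (n1 n) (n2 n) (\<lambda>i. X i \<omega>)"
          using jel_stat_ge[OF m _ k less_imp_le[OF \<delta>] small] \<kappa> n by simp
        moreover have "ereal c < ereal (2 * \<delta> * (?U1 \<omega> - ?U2 \<omega>) - 1)"
        proof -
          have "\<theta>1 - \<theta>2 = 4 * \<epsilon>" "\<Delta> / 2 = 2 * \<epsilon>" by (simp_all add: \<epsilon>_def \<Delta>_def)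
          with u have "\<Delta> / 2 \<le> ?U1 \<omega> - ?U2 \<omega>" by linarith
          then have "2 * \<delta> * (\<Delta> / 2) \<le> 2 * \<delta> * (?U1 \<omega> - ?U2 \<omega>)"
            using \<delta> by (intro mult_left_mono) auto
          moreover have "2 * \<delta> * (\<Delta> / 2) = \<bar>c\<bar> + 2" using \<Delta> by (simp add: \<delta>_def)
          ultimately show ?thesis unfolding less_ereal.simps by linarith
        qed
        ultimately have "ereal c < jel_stat (n1 n) (n2 n) (\<lambda>i. X i \<omega>)"
          by (rule less_le_trans[rotated])
        then have "\<omega> \<in> A n" using \<omega>(1) by (simp add: A_def)
        with \<omega>(2) show False by contradiction
      qed
      have "prob (space M - A n) \<le> prob (?B1 \<union> ?B2 \<union> ?B3)"
        using e by (intro finite_measure_mono[OF sub]) auto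
      also have "\<dots> \<le> prob ?B1 + prob ?B2 + prob ?B3"
        using e by (intro order.trans[OF measure_Un_le] add_mono measure_Un_le) auto
      also have "\<dots> \<le> bad n" unfolding bad_def using p1 p2 p3 by linarith
      finally show ?case using prob_compl[OF A[of n]] by linarith
    qed
  qed
  then have "(\<lambda>n. prob (A n)) \<longlonglongrightarrow> 1"
    by (rule tendsto_sandwich[OF _ _ _ tendsto_const])
      (use tendsto_diff[OF tendsto_const[of 1] bad0] in auto)
  then show ?thesis unfolding A_def c_def .
qed

end
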